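(* Let $\mathcal{A}\otimes\mathcal{C}$, $\epsilon$, $\underline{D}$, $\underline{x}$, $\underline{D}_A$, $\underline{x}_A$, $e_A$, $L_{ij}$, $C_{ij}$ be as defined in the context. Let $A$ be a list of distinct elements of $\{1,\dots,N\}$. Then the following three elements of $\mathcal{A}\otimes\mathcal{C}$ coincide, and their common value is denoted $O_A$: $$O_A=\tfrac12\big(\underline{D}\,\underline{x}_A e_A-e_A\underline{x}_A\underline{D}-\epsilon e_A\big)$$ $$=\tfrac12\big(e_A\underline{D}_A\,\underline{x}-\underline{x}\,\underline{D}_A e_A-\epsilon e_A\big)$$ $$=\tfrac12\Big(-\epsilon+\sum_{j\in A}\ \sum_{i\in\{1,\dots,N\}\setminus(A\setminus\{j\})}C_{ij}e_ie_j-\sum_{\{i,j\}\subset A}2L_{ij}e_ie_j\Big)e_A ,$$ where the last sum runs over the two-element subsets $\{i,j\}$ of $A$. Moreover, $O_A$ satisfies $$\underline{D}\,O_A=(-1)^{|A|}O_A\,\underline{D}\qquad\text{and}\qquad \underline{x}\,O_A=(-1)^{|A|}O_A\,\underline{x}.$$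
   Context: Let $\mathbb{K}$ be $\mathbb{R}$ or $\mathbb{C}$ and $N\ge1$. $\mathcal{A}$ is the unital associative $\mathbb{K}$-algebra generated by $x_1,\dots,x_N,p_1,\dots,p_N$ subject to the relations, for all $i,j$, $$[x_i,x_j]=0,\quad [p_i,p_j]=0,\quad \Big[\tfrac12\sum_{i=1}^N p_i^2,\,x_j\Big]=p_j,\quad \Big[\tfrac12\sum_{i=1}^N x_i^2,\,p_j\Big]=-x_j,$$ where $[a,b]=ab-ba$. Fix $\epsilon\in\{+1,-1\}$. $\mathcal{C}$ is the Clifford algebra over $\mathbb{K}$ generated by $e_1,\dots,e_N$ with $e_ie_j+e_je_i=2\epsilon\delta_{ij}$. In $\mathcal{A}\otimes\mathcal{C}$ the tensor sign is omitted, and the $e_i$ commute with all $x_j,p_j$. $\underline{D}=\sum_{i=1}^N e_ip_i$, $\underline{x}=\sum_{i=1}^N e_ix_i$, $L_{ij}=x_ip_j-x_jp_i$, $C_{ij}=[p_i,x_j]$ (one has $C_{ij}=C_{ji}$, $L_{ij}=-L_{ji}$). A list is a finite (possibly empty) sequence $A=a_1\cdots a_n$ of distinct elements of $\{1,\dots,N\}$, $|A|=n$; $e_A=e_{a_1}\cdots e_{a_n}$, $e_\emptyset=1$. In set operations and membership, a list is viewed as its underlying set. $\underline{D}_A=\sum_{a\in A}p_ae_a$ and $\underline{x}_A=\sum_{a\in A}x_ae_a$. *)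

theory Defs
  imports Complex_Main "HOL-Library.Poly_Mapping" "HOL-Algebra.QuotRing" "HOL-Algebra.Module"
begin

section \<open>The ground field\<close>

text \<open>
  Up to isomorphism, the members of this class are exactly the real and the complex field:
  either every element is real, or the field is spanned over the reals by 1 and a square
  root of \<open>-1\<close>.
\<close>

class real_or_complex = real_field +
  assumes real_or_complex:
    "(\<forall>z. \<exists>a. z = a *\<^sub>R 1) \<or>
     (\<exists>i. i * i = - 1 \<and> (\<forall>z. \<exists>a b. z = a *\<^sub>R 1 + b *\<^sub>R i))"

instance real :: real_or_complex
  by standard simp

instance complex :: real_or_complex
proof
  have "\<forall>z. \<exists>a b. z = a *\<^sub>R 1 + b *\<^sub>R \<i>"
  proof
    fix z :: complex
    have "z = Re z *\<^sub>R 1 + Im z *\<^sub>R \<i>"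
      by (simp add: complex_eq_iff)
    then show "\<exists>a b. z = a *\<^sub>R 1 + b *\<^sub>R \<i>"
      by blast
  qed
  then show "(\<forall>z::complex. \<exists>a. z = a *\<^sub>R 1) \<or>
      (\<exists>i::complex. i * i = - 1 \<and> (\<forall>z. \<exists>a b. z = a *\<^sub>R 1 + b *\<^sub>R i))"
    by (intro disjI2 exI[of _ \<i>]) simp
qed


section \<open>Algebras by generators and relations, and their tensor product\<close>

text \<open>
  A (not necessarily commutative) algebra over the field \<open>'k\<close> is represented by the record
  type \<open>('k, 'a) module\<close>: a ring together with a scalar multiplication by elements of \<open>'k\<close>.
  The finitely supported function \<open>f :: 'm \<Rightarrow>\<^sub>0 'k\<close> stands for the formal linear combination
  of the \<open>m\<close> with coefficients \<open>lookup f m\<close>.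
\<close>

definition monoid_algebra :: "('m, 'z) monoid_scheme \<Rightarrow> ('k::field, 'm \<Rightarrow>\<^sub>0 'k) module" where
  "monoid_algebra M =
    \<lparr> carrier = {f. Poly_Mapping.keys f \<subseteq> carrier M},
      mult = (\<lambda>f g. \<Sum>u\<in>Poly_Mapping.keys f. \<Sum>v\<in>Poly_Mapping.keys g.
                Poly_Mapping.single (u \<otimes>\<^bsub>M\<^esub> v)
                  (Poly_Mapping.lookup f u * Poly_Mapping.lookup g v)),
      one = Poly_Mapping.single \<one>\<^bsub>M\<^esub> 1,
      zero = 0,
      add = (+),
      smult = (\<lambda>c f. Poly_Mapping.map ((*) c) f) \<rparr>"

definition free_monoid :: "'g set \<Rightarrow> 'g list monoid" where
  "free_monoid X = \<lparr> carrier = lists X, mult = (@), one = [] \<rparr>"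

definition free_algebra :: "'g set \<Rightarrow> ('k::field, 'g list \<Rightarrow>\<^sub>0 'k) module" where
  "free_algebra X = monoid_algebra (free_monoid X)"

definition free_gen :: "'g \<Rightarrow> ('g list \<Rightarrow>\<^sub>0 'k::field)" where
  "free_gen g = Poly_Mapping.single [g] 1"

text \<open>
  The quotient of a unital algebra by a two-sided ideal; such an ideal is automatically a
  linear subspace.
\<close>

definition alg_quot :: "('k, 'a) module \<Rightarrow> 'a set \<Rightarrow> ('k, 'a set) module" where
  "alg_quot R I =
    \<lparr> carrier = carrier (R Quot I),
      mult = mult (R Quot I),
      one = one (R Quot I),
      zero = zero (R Quot I),
      add = add (R Quot I),
      smult = (\<lambda>c X. \<Union>a\<in>X. I +>\<^bsub>R\<^esub> (c \<odot>\<^bsub>R\<^esub> a)) \<rparr>"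

definition presented_algebra ::
    "'g set \<Rightarrow> ('g list \<Rightarrow>\<^sub>0 'k) set \<Rightarrow> ('k::field, ('g list \<Rightarrow>\<^sub>0 'k) set) module" where
  "presented_algebra X S =
    alg_quot (free_algebra X) (genideal (free_algebra X) S)"

definition presented_gen ::
    "'g set \<Rightarrow> ('g list \<Rightarrow>\<^sub>0 'k::field) set \<Rightarrow> 'g \<Rightarrow> ('g list \<Rightarrow>\<^sub>0 'k) set" where
  "presented_gen X S g =
    genideal (free_algebra X) S +>\<^bsub>free_algebra X\<^esub> free_gen g"

text \<open>
  The tensor product of two algebras \<open>R\<close> and \<open>S\<close> is the free vector space on the set of pairs,
  with the product that extends \<open>(a, c) (a', c') = (a a', c c')\<close> bilinearly, modulo the
  bilinearity relations. The subspace spanned by these relations is an ideal.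
\<close>

definition bilinear_relations ::
    "('k::field, 'a) module \<Rightarrow> ('k, 'c) module \<Rightarrow> ('a \<times> 'c \<Rightarrow>\<^sub>0 'k) set" where
  "bilinear_relations R S =
     {Poly_Mapping.single (a \<oplus>\<^bsub>R\<^esub> a', c) 1
        - Poly_Mapping.single (a, c) 1 - Poly_Mapping.single (a', c) 1 | a a' c.
        a \<in> carrier R \<and> a' \<in> carrier R \<and> c \<in> carrier S}
   \<union> {Poly_Mapping.single (a, c \<oplus>\<^bsub>S\<^esub> c') 1
        - Poly_Mapping.single (a, c) 1 - Poly_Mapping.single (a, c') 1 | a c c'.
        a \<in> carrier R \<and> c \<in> carrier S \<and> c' \<in> carrier S}
   \<union> {Poly_Mapping.single (k \<odot>\<^bsub>R\<^esub> a, c) 1 - Poly_Mapping.single (a, c) k | k a c.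
        a \<in> carrier R \<and> c \<in> carrier S}
   \<union> {Poly_Mapping.single (a, k \<odot>\<^bsub>S\<^esub> c) 1 - Poly_Mapping.single (a, c) k | k a c.
        a \<in> carrier R \<and> c \<in> carrier S}"

definition tensor_ideal ::
    "('k::field, 'a) module \<Rightarrow> ('k, 'c) module \<Rightarrow> ('a \<times> 'c \<Rightarrow>\<^sub>0 'k) set" where
  "tensor_ideal R S = genideal (monoid_algebra (R \<times>\<times> S)) (bilinear_relations R S)"

definition tensor_algebra ::
    "('k::field, 'a) module \<Rightarrow> ('k, 'c) module \<Rightarrow> ('k, ('a \<times> 'c \<Rightarrow>\<^sub>0 'k) set) module" where
  "tensor_algebra R S = alg_quot (monoid_algebra (R \<times>\<times> S)) (tensor_ideal R S)"

definition pure_tensor ::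
    "('k::field, 'a) module \<Rightarrow> ('k, 'c) module \<Rightarrow> 'a \<Rightarrow> 'c \<Rightarrow> ('a \<times> 'c \<Rightarrow>\<^sub>0 'k) set" where
  "pure_tensor R S a c =
    tensor_ideal R S +>\<^bsub>monoid_algebra (R \<times>\<times> S)\<^esub> Poly_Mapping.single (a, c) 1"

definition commutator :: "('a, 'z) ring_scheme \<Rightarrow> 'a \<Rightarrow> 'a \<Rightarrow> 'a" where
  "commutator R a b = (a \<otimes>\<^bsub>R\<^esub> b) \<ominus>\<^bsub>R\<^esub> (b \<otimes>\<^bsub>R\<^esub> a)"


section \<open>The algebra generated by the x and p\<close>

datatype xp = GenX nat | GenP nat

definition xp_gens :: "nat \<Rightarrow> xp set" where
  "xp_gens N = GenX ` {1..N} \<union> GenP ` {1..N}"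

text \<open>
  The relation \<open>l = r\<close> is encoded by the element \<open>l - r\<close> of the free algebra.
\<close>

definition xp_relations :: "nat \<Rightarrow> (xp list \<Rightarrow>\<^sub>0 'k::field) set" where
  "xp_relations N =
    (let F = free_algebra (xp_gens N); x = (\<lambda>i. free_gen (GenX i)); p = (\<lambda>i. free_gen (GenP i))
     in {commutator F (x i) (x j) | i j. i \<in> {1..N} \<and> j \<in> {1..N}}
      \<union> {commutator F (p i) (p j) | i j. i \<in> {1..N} \<and> j \<in> {1..N}}
      \<union> {commutator F ((1/2) \<odot>\<^bsub>F\<^esub> (\<Oplus>\<^bsub>F\<^esub>i\<in>{1..N}. p i \<otimes>\<^bsub>F\<^esub> p i)) (x j) \<ominus>\<^bsub>F\<^esub> p j | j.
           j \<in> {1..N}}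
      \<union> {commutator F ((1/2) \<odot>\<^bsub>F\<^esub> (\<Oplus>\<^bsub>F\<^esub>i\<in>{1..N}. x i \<otimes>\<^bsub>F\<^esub> x i)) (p j)
           \<ominus>\<^bsub>F\<^esub> (\<ominus>\<^bsub>F\<^esub> x j) | j. j \<in> {1..N}})"

definition alg_A :: "nat \<Rightarrow> ('k::field, (xp list \<Rightarrow>\<^sub>0 'k) set) module" where
  "alg_A N = presented_algebra (xp_gens N) (xp_relations N)"


section \<open>The Clifford algebra\<close>

definition clifford_relations :: "nat \<Rightarrow> 'k::field \<Rightarrow> (nat list \<Rightarrow>\<^sub>0 'k) set" where
  "clifford_relations N \<epsilon> =
    (let F = free_algebra {1..N}; e = free_gen
     in {((e i \<otimes>\<^bsub>F\<^esub> e j) \<oplus>\<^bsub>F\<^esub> (e j \<otimes>\<^bsub>F\<^esub> e i))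
           \<ominus>\<^bsub>F\<^esub> ((2 * \<epsilon> * (if i = j then 1 else 0)) \<odot>\<^bsub>F\<^esub> \<one>\<^bsub>F\<^esub>) | i j.
           i \<in> {1..N} \<and> j \<in> {1..N}})"

definition alg_C :: "nat \<Rightarrow> 'k::field \<Rightarrow> ('k, (nat list \<Rightarrow>\<^sub>0 'k) set) module" where
  "alg_C N \<epsilon> = presented_algebra {1..N} (clifford_relations N \<epsilon>)"


section \<open>Elements of the tensor product\<close>

type_synonym 'k AC = "((xp list \<Rightarrow>\<^sub>0 'k) set \<times> (nat list \<Rightarrow>\<^sub>0 'k) set \<Rightarrow>\<^sub>0 'k) set"

definition alg_AC :: "nat \<Rightarrow> 'k::field \<Rightarrow> ('k, 'k AC) module" where
  "alg_AC N \<epsilon> = tensor_algebra (alg_A N) (alg_C N \<epsilon>)"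

definition x_el :: "nat \<Rightarrow> 'k::field \<Rightarrow> nat \<Rightarrow> 'k AC" where
  "x_el N \<epsilon> i = pure_tensor (alg_A N) (alg_C N \<epsilon>)
     (presented_gen (xp_gens N) (xp_relations N) (GenX i)) \<one>\<^bsub>alg_C N \<epsilon>\<^esub>"

definition p_el :: "nat \<Rightarrow> 'k::field \<Rightarrow> nat \<Rightarrow> 'k AC" where
  "p_el N \<epsilon> i = pure_tensor (alg_A N) (alg_C N \<epsilon>)
     (presented_gen (xp_gens N) (xp_relations N) (GenP i)) \<one>\<^bsub>alg_C N \<epsilon>\<^esub>"

definition e_el :: "nat \<Rightarrow> 'k::field \<Rightarrow> nat \<Rightarrow> 'k AC" where
  "e_el N \<epsilon> i = pure_tensor (alg_A N) (alg_C N \<epsilon>)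
     \<one>\<^bsub>alg_A N\<^esub> (presented_gen {1..N} (clifford_relations N \<epsilon>) i)"

definition e_list :: "nat \<Rightarrow> 'k::field \<Rightarrow> nat list \<Rightarrow> 'k AC" where
  "e_list N \<epsilon> A = foldr (\<lambda>a r. e_el N \<epsilon> a \<otimes>\<^bsub>alg_AC N \<epsilon>\<^esub> r) A \<one>\<^bsub>alg_AC N \<epsilon>\<^esub>"

definition D_full :: "nat \<Rightarrow> 'k::field \<Rightarrow> 'k AC" where
  "D_full N \<epsilon> = (\<Oplus>\<^bsub>alg_AC N \<epsilon>\<^esub>i\<in>{1..N}. e_el N \<epsilon> i \<otimes>\<^bsub>alg_AC N \<epsilon>\<^esub> p_el N \<epsilon> i)"

definition x_full :: "nat \<Rightarrow> 'k::field \<Rightarrow> 'k AC" where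
  "x_full N \<epsilon> = (\<Oplus>\<^bsub>alg_AC N \<epsilon>\<^esub>i\<in>{1..N}. e_el N \<epsilon> i \<otimes>\<^bsub>alg_AC N \<epsilon>\<^esub> x_el N \<epsilon> i)"

definition D_list :: "nat \<Rightarrow> 'k::field \<Rightarrow> nat list \<Rightarrow> 'k AC" where
  "D_list N \<epsilon> A = (\<Oplus>\<^bsub>alg_AC N \<epsilon>\<^esub>a\<in>set A. p_el N \<epsilon> a \<otimes>\<^bsub>alg_AC N \<epsilon>\<^esub> e_el N \<epsilon> a)"

definition x_list :: "nat \<Rightarrow> 'k::field \<Rightarrow> nat list \<Rightarrow> 'k AC" where
  "x_list N \<epsilon> A = (\<Oplus>\<^bsub>alg_AC N \<epsilon>\<^esub>a\<in>set A. x_el N \<epsilon> a \<otimes>\<^bsub>alg_AC N \<epsilon>\<^esub> e_el N \<epsilon> a)"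

definition L_el :: "nat \<Rightarrow> 'k::field \<Rightarrow> nat \<Rightarrow> nat \<Rightarrow> 'k AC" where
  "L_el N \<epsilon> i j =
     (x_el N \<epsilon> i \<otimes>\<^bsub>alg_AC N \<epsilon>\<^esub> p_el N \<epsilon> j)
     \<ominus>\<^bsub>alg_AC N \<epsilon>\<^esub> (x_el N \<epsilon> j \<otimes>\<^bsub>alg_AC N \<epsilon>\<^esub> p_el N \<epsilon> i)"

definition C_el :: "nat \<Rightarrow> 'k::field \<Rightarrow> nat \<Rightarrow> nat \<Rightarrow> 'k AC" where
  "C_el N \<epsilon> i j = commutator (alg_AC N \<epsilon>) (p_el N \<epsilon> i) (x_el N \<epsilon> j)"

text \<open>
  The sum of \<open>2 L\<^sub>i\<^sub>j e\<^sub>i e\<^sub>j\<close> over the two-element subsets of \<open>A\<close>. Both \<open>L\<^sub>i\<^sub>j\<close> and, for distinct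
  indices, \<open>e\<^sub>i e\<^sub>j\<close> change sign when \<open>i\<close> and \<open>j\<close> are exchanged, so each subset may be
  represented by the pair with \<open>i < j\<close>.
\<close>

definition L_sum :: "nat \<Rightarrow> 'k::field \<Rightarrow> nat list \<Rightarrow> 'k AC" where
  "L_sum N \<epsilon> A =
     (\<Oplus>\<^bsub>alg_AC N \<epsilon>\<^esub>s\<in>{(i, j). i \<in> set A \<and> j \<in> set A \<and> i < j}.
        case s of (i, j) \<Rightarrow>
          2 \<odot>\<^bsub>alg_AC N \<epsilon>\<^esub>
            (L_el N \<epsilon> i j \<otimes>\<^bsub>alg_AC N \<epsilon>\<^esub> e_el N \<epsilon> i \<otimes>\<^bsub>alg_AC N \<epsilon>\<^esub> e_el N \<epsilon> j))"

definition C_sum :: "nat \<Rightarrow> 'k::field \<Rightarrow> nat list \<Rightarrow> 'k AC" where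
  "C_sum N \<epsilon> A =
     (\<Oplus>\<^bsub>alg_AC N \<epsilon>\<^esub>j\<in>set A. \<Oplus>\<^bsub>alg_AC N \<epsilon>\<^esub>i\<in>{1..N} - (set A - {j}).
        C_el N \<epsilon> i j \<otimes>\<^bsub>alg_AC N \<epsilon>\<^esub> e_el N \<epsilon> i \<otimes>\<^bsub>alg_AC N \<epsilon>\<^esub> e_el N \<epsilon> j)"

end

(*
The three expressions agree already before summation. For j in A, moving e_A past e_j e_i
produces the sign that turns the summand of index (i, j) of the first form into
[p_i, x_j] e_i e_j e_A when i = j or i is not in A, and into (p_i x_j + x_j p_i) e_i e_j e_A
otherwise; in the latter case the summands of (i, j) and (j, i) add up to -2 L_ij e_i e_j e_A.
The second form is treated in the same way, using C_ij = C_ji.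

For the (anti)commutation, x_A e_A = (-1)^(|A|-1) e_A x_A makes the mixed terms cancel, so that
2 (D O_A - (-1)^|A| O_A D) = [D^2, x_A] e_A - epsilon (D e_A - (-1)^|A| e_A D). Here D^2 is
epsilon times the sum of the p_i^2, so both terms are equal to 2 epsilon D_A e_A. The claim for x
follows in the same way from the second form.

These computations are made in a type of class ring. They are transferred to the tensor product
by embedding every ring with a carrier set, without its unit, as a factor of the product of all
such rings over the same type.
*)
theory Submission
  imports Defs "HOL-Algebra.Multiplicative_Group"
begin

section \<open>The identities in a type of class ring\<close>

text \<open>The tensor product depends on the variables \<open>N\<close> and
  \<open>\<epsilon>\<close>, and a HOL type cannot depend on terms, so no type can be carved out for
  this one algebra. The product of all rings over one record type depends on types only and contains
  each of them as a factor; this is what makes type class reasoning available. The price is a ring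
  with neither scalars nor unit. Hence everything is stated after doubling: the ring part treats
  \<open>2 O_A\<close>, half sums of squares occur only through \<open>\<Delta> + \<Delta>\<close>
  and \<open>\<rho> + \<rho>\<close>, and \<open>\<epsilon>\<close> enters only as the common square
  \<open>q\<close> of the \<open>e i\<close>.

  No basis or normal form of the algebras is involved. It suffices that both free algebras map
  homomorphically to the tensor product, that the relations go to zero, and that the two images
  commute elementwise. The relation \<open>[\<Delta>, x j] = p j\<close> acts twice: by the Jacobi
  identity it forces \<open>C i j = C j i\<close>, and it turns the commutator of the square of
  \<open>DD\<close> with \<open>XL A\<close> into a multiple of \<open>DL A\<close>.\<close>

lemma sum_distinct_pairs:
  fixes f :: "'i::linorder \<Rightarrow> 'i \<Rightarrow> 'a::comm_monoid_add"
  assumes "finite B"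
  shows "(\<Sum>j\<in>B. \<Sum>i\<in>B - {j}. f i j) =
    (\<Sum>(i, j)\<in>{(i, j). i \<in> B \<and> j \<in> B \<and> i < j}. f i j + f j i)"
proof -
  let ?P = "{(i, j). i \<in> B \<and> j \<in> B \<and> i < j}"
  have fin: "finite ?P"
    by (rule finite_subset[of _ "B \<times> B"]) (use assms in auto)
  have "(\<Sum>j\<in>B. \<Sum>i\<in>B - {j}. f i j) = (\<Sum>(j, i)\<in>(SIGMA j:B. B - {j}). f i j)"
    using assms by (simp add: sum.Sigma)
  \<comment> \<open>The off-diagonal pairs are the disjoint union of a triangle and its mirror
    image.\<close>
  also have "(SIGMA j:B. B - {j}) = ?P \<union> prod.swap ` ?P"
    by (auto simp: image_iff neq_iff)
  also have "(\<Sum>(j, i)\<in>?P \<union> prod.swap ` ?P. f i j) =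
      (\<Sum>(j, i)\<in>?P. f i j) + (\<Sum>(j, i)\<in>prod.swap ` ?P. f i j)"
    using fin by (intro sum.union_disjoint) auto
  also have "(\<Sum>(j, i)\<in>prod.swap ` ?P. f i j) = (\<Sum>(i, j)\<in>?P. f i j)"
    by (subst sum.reindex) (auto simp: case_prod_unfold)
  finally show ?thesis
    by (simp add: case_prod_unfold sum.distrib add.commute)
qed

text \<open>
  The terms \<open>D E X D\<close> and \<open>D X E D\<close> of the graded commutator cancel because \<open>X E = \<mp> E X\<close>.
\<close>

lemma graded_commute:
  fixes D X E L r :: "'r::ring"
  assumes XE: "X * E = (if s then - (E * X) else E * X)"
    and DE: "D * E = (if s then E * D + L * E + L * E else - (E * D) + L * E + L * E)"
    and DDX: "D * D * X - X * (D * D) = r * (L + L)"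
    and DDE: "D * D * E = E * (D * D)"
    and Dr: "D * r = r * D"
  defines "W \<equiv> D * X * E - E * X * D - r * E"
  shows "D * W = (if s then W * D else - (W * D))"
proof -
  have "D * (D * X * E) = (D * D * X - X * (D * D)) * E + X * (D * D * E)"
    by (simp add: algebra_simps)
  then have 1: "D * (D * X * E) = r * (L * E) + r * (L * E) + X * (E * (D * D))"
    unfolding DDX DDE by (simp add: algebra_simps)
  have "D * (r * E) = r * (D * E)"
    by (metis Dr mult.assoc)
  then have 2: "D * (r * E) = (if s then r * (E * D) + r * (L * E) + r * (L * E)
      else - (r * (E * D)) + r * (L * E) + r * (L * E))"
    unfolding DE by (simp add: algebra_simps)
  \<comment> \<open>Oriented so that both \<open>E * X * D\<close> and \<open>D * E * X\<close> are
    rewritten to products containing \<open>X * E\<close>; the terms in \<open>r * (L * E)\<close>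
    from \<open>1\<close> and \<open>2\<close> cancel.\<close>
  have 3: "E * X = (if s then - (X * E) else X * E)"
    using XE by simp
  show ?thesis
    unfolding W_def right_diff_distrib 1 2 unfolding 3 by (simp add: algebra_simps)
qed

text \<open>
  Class ring has no unit, and the embedding used for the transfer does not preserve units:
  \<open>u\<close> stands for \<open>1\<close> and \<open>q\<close> for \<open>\<epsilon>\<close>. The half sums of squares \<open>\<Delta>\<close> and \<open>\<rho>\<close> are parameters
  because one cannot divide by \<open>2\<close>.
\<close>

locale clifford_weyl =
  fixes I :: "nat set" and e x p :: "nat \<Rightarrow> 'r::ring" and q u \<Delta> \<rho> :: 'r
  assumes finite_I: "finite I"
    and e_anti: "\<lbrakk>i \<in> I; j \<in> I; i \<noteq> j\<rbrakk> \<Longrightarrow> e i * e j = - (e j * e i)"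
    and e_square: "i \<in> I \<Longrightarrow> e i * e i = q"
    and x_e: "\<lbrakk>i \<in> I; j \<in> I\<rbrakk> \<Longrightarrow> x i * e j = e j * x i"
    and p_e: "\<lbrakk>i \<in> I; j \<in> I\<rbrakk> \<Longrightarrow> p i * e j = e j * p i"
    and x_x: "\<lbrakk>i \<in> I; j \<in> I\<rbrakk> \<Longrightarrow> x i * x j = x j * x i"
    and p_p: "\<lbrakk>i \<in> I; j \<in> I\<rbrakk> \<Longrightarrow> p i * p j = p j * p i"
    and \<Delta>: "\<Delta> + \<Delta> = (\<Sum>i\<in>I. p i * p i)"
    and \<rho>: "\<rho> + \<rho> = (\<Sum>i\<in>I. x i * x i)"
    and \<Delta>_x: "j \<in> I \<Longrightarrow> \<Delta> * x j - x j * \<Delta> = p j"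
    and \<rho>_p: "j \<in> I \<Longrightarrow> \<rho> * p j - p j * \<rho> = - x j"
    and u_e: "i \<in> I \<Longrightarrow> u * e i = e i * u"
    and u_x: "i \<in> I \<Longrightarrow> u * x i = x i * u"
    and u_p: "i \<in> I \<Longrightarrow> u * p i = p i * u"
begin

definition E :: "nat list \<Rightarrow> 'r" where "E A = foldr (\<lambda>a r. e a * r) A u"
definition DD :: 'r where "DD = (\<Sum>i\<in>I. e i * p i)"
definition XX :: 'r where "XX = (\<Sum>i\<in>I. e i * x i)"
definition DL :: "nat list \<Rightarrow> 'r" where "DL A = (\<Sum>a\<in>set A. p a * e a)"
definition XL :: "nat list \<Rightarrow> 'r" where "XL A = (\<Sum>a\<in>set A. x a * e a)"
definition C :: "nat \<Rightarrow> nat \<Rightarrow> 'r" where "C i j = p i * x j - x j * p i"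
definition L :: "nat \<Rightarrow> nat \<Rightarrow> 'r" where "L i j = x i * p j - x j * p i"
definition CS :: "nat list \<Rightarrow> 'r" where
  "CS A = (\<Sum>j\<in>set A. \<Sum>i\<in>I - (set A - {j}). C i j * e i * e j)"
text \<open>The scalar 2 of the sum over two-element subsets appears as a repeated summand, since
  class \<open>ring\<close> offers no numerals.\<close>

definition LS :: "nat list \<Rightarrow> 'r" where
  "LS A = (\<Sum>(i, j)\<in>{(i, j). i \<in> set A \<and> j \<in> set A \<and> i < j}. L i j * e i * e j + L i j * e i * e j)"

section \<open>Commutation rules for the generators and for products of the
  \<open>e i\<close>\<close>

lemma E_Nil: "E [] = u" and E_Cons: "E (a # A) = e a * E A"
  by (simp_all add: E_def)

lemma x_e': "\<lbrakk>i \<in> I; j \<in> I\<rbrakk> \<Longrightarrow> x i * (e j * z) = e j * (x i * z)"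
  and p_e': "\<lbrakk>i \<in> I; j \<in> I\<rbrakk> \<Longrightarrow> p i * (e j * z) = e j * (p i * z)"
  by (simp_all flip: mult.assoc add: x_e p_e)

text \<open>Since \<open>p i\<close> is the commutator of \<open>\<Delta>\<close> and
  \<open>x i\<close>, \<open>C i j\<close> is the double commutator
  \<open>[[\<Delta>, x i], x j]\<close>. By the Jacobi identity its antisymmetric part is
  \<open>[\<Delta>, [x i, x j]]\<close>, which vanishes.\<close>

lemma C_sym:
  assumes "i \<in> I" "j \<in> I"
  shows "C i j = C j i"
proof -
  have "C i j = (\<Delta> * x i - x i * \<Delta>) * x j - x j * (\<Delta> * x i - x i * \<Delta>)"
    by (simp add: C_def \<Delta>_x assms)
  also have "\<dots> = (\<Delta> * x j - x j * \<Delta>) * x i - x i * (\<Delta> * x j - x j * \<Delta>)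
     + (\<Delta> * (x i * x j - x j * x i) - (x i * x j - x j * x i) * \<Delta>)"
    by (simp add: algebra_simps)
  also have "\<dots> = C j i"
    by (simp add: C_def \<Delta>_x x_x[OF assms] assms)
  finally show ?thesis .
qed

text \<open>All \<open>e j\<close> have the same square \<open>q\<close>, so \<open>q\<close> may be
  read as the square of the very \<open>e j\<close> it has to pass.\<close>

lemma q_e: "i \<in> I \<Longrightarrow> j \<in> I \<Longrightarrow> q * e j = e j * q"
proof -
  assume "i \<in> I" "j \<in> I"
  then have "e j * e j * e j = e j * (e j * e j)" by (simp add: mult.assoc)
  then show "q * e j = e j * q" using \<open>j \<in> I\<close> by (simp add: e_square)
qed

lemma q_x: "i \<in> I \<Longrightarrow> q * x i = x i * q" and q_p: "i \<in> I \<Longrightarrow> q * p i = p i * q"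
  using e_square[of i, symmetric] by (simp_all add: mult.assoc x_e p_e x_e' p_e')

lemma x_p_E:
  assumes "set A \<subseteq> I" "i \<in> I"
  shows x_E: "x i * E A = E A * x i" and p_E: "p i * E A = E A * p i"
  using assms
  by (induction A) (simp_all add: E_Nil E_Cons u_x u_p x_e' p_e' mult.assoc)

lemma q_E: "set A \<subseteq> I \<Longrightarrow> i \<in> I \<Longrightarrow> q * E A = E A * q"
proof (induction A)
  case Nil
  then show ?case
    using e_square[of i, symmetric] by (simp add: E_Nil u_e flip: mult.assoc) (simp add: u_e mult.assoc)
next
  case (Cons a A)
  then show ?case by (simp add: E_Cons q_e mult.assoc[symmetric]) (simp add: mult.assoc)
qed

text \<open>Passing \<open>e i\<close> through the product costs a sign for each factor other than
  \<open>e i\<close> itself. The sign is therefore that of \<open>length A\<close> if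
  \<open>i\<close> is not in \<open>A\<close> and the opposite one if it is, since a distinct list
  contains \<open>i\<close> only once. The equation of truth values in the condition covers both
  cases.\<close>

lemma e_E:
  assumes "distinct A" "set A \<subseteq> I" "i \<in> I"
  shows "e i * E A = (if even (length A) = (i \<notin> set A) then E A * e i else - (E A * e i))"
  using assms
proof (induction A)
  case Nil
  then show ?case by (simp add: E_Nil u_e)
next
  case (Cons a A)
  show ?case
  proof (cases "i = a")
    case True
    \<comment> \<open>By distinctness \<open>a\<close> does not occur in the tail, so the induction
      hypothesis gives the sign of the tail; the head commutes with itself.\<close>
    then have "e a * E A = (if even (length A) then E A * e a else - (E A * e a))"
      using Cons by simp
    then have "e a * (e a * E A) = (if even (length A) then e a * (E A * e a) else - (e a * (E A * e a)))"
      by (metis mult_minus_right)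
    then show ?thesis
      using True by (simp add: E_Cons mult.assoc)
  next
    case False
    then have "e i * E (a # A) = - (e a * (e i * E A))"
      using Cons.prems by (simp add: E_Cons e_anti[of i a] flip: mult.assoc)
    then show ?thesis
      using False Cons by (simp add: E_Cons mult.assoc)
  qed
qed

text \<open>Off the diagonal, the summands at \<open>(i, j)\<close> and \<open>(j, i)\<close> cancel
  because the \<open>e i\<close> anticommute and the \<open>y i\<close> commute; on the diagonal
  \<open>e i * e i\<close> is \<open>q\<close>. The family \<open>y\<close> will be \<open>p\<close>
  or \<open>x\<close>.\<close>

lemma square_sum_e:
  assumes "\<And>i j. \<lbrakk>i \<in> I; j \<in> I\<rbrakk> \<Longrightarrow> y i * e j = e j * y i"
    and "\<And>i j. \<lbrakk>i \<in> I; j \<in> I\<rbrakk> \<Longrightarrow> y i * y j = y j * y i"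
  shows "(\<Sum>i\<in>I. e i * y i) * (\<Sum>i\<in>I. e i * y i) = q * (\<Sum>i\<in>I. y i * y i)"
proof -
  let ?f = "\<lambda>i j. e i * y i * (e j * y j)"
  have f: "?f i j = e i * e j * (y i * y j)" if "i \<in> I" "j \<in> I" for i j
    using assms(1)[OF that] by (metis mult.assoc)
  have "(\<Sum>i\<in>I. e i * y i) * (\<Sum>i\<in>I. e i * y i) = (\<Sum>j\<in>I. \<Sum>i\<in>I. ?f i j)"
    unfolding sum_product by (rule sum.swap)
  also have "\<dots> = (\<Sum>j\<in>I. ?f j j + (\<Sum>i\<in>I - {j}. ?f i j))"
    using finite_I by (intro sum.cong refl) (simp add: sum.remove)
  also have "\<dots> = (\<Sum>j\<in>I. ?f j j) + (\<Sum>(i, j)\<in>{(i, j). i \<in> I \<and> j \<in> I \<and> i < j}. ?f i j + ?f j i)"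
    by (simp add: sum.distrib sum_distinct_pairs finite_I)
  also have "(\<Sum>(i, j)\<in>{(i, j). i \<in> I \<and> j \<in> I \<and> i < j}. ?f i j + ?f j i) = 0"
  proof (rule sum.neutral, clarsimp simp: f)
    fix i j assume "i \<in> I" "j \<in> I" "i < j"
    then have "e i * e j = - (e j * e i)" "y i * y j = y j * y i"
      using e_anti[of i j] assms(2)[of i j] by simp_all
    then show "e i * e j * (y i * y j) + e j * e i * (y j * y i) = 0"
      by simp
  qed
  also have "(\<Sum>j\<in>I. ?f j j) = q * (\<Sum>i\<in>I. y i * y i)"
    by (simp add: f e_square sum_distrib_left)
  finally show ?thesis by simp
qed

lemma DD_square: "DD * DD = q * (\<Delta> + \<Delta>)"
  unfolding DD_def \<Delta> by (rule square_sum_e) (simp_all add: p_e p_p)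

lemma XX_square: "XX * XX = q * (\<rho> + \<rho>)"
  unfolding XX_def \<rho> by (rule square_sum_e) (simp_all add: x_e x_x)

section \<open>Moving \<open>E A\<close> past vectors supported on the list \<open>A\<close>\<close>

context
  fixes A
  assumes A: "distinct A" "set A \<subseteq> I"
begin

lemma in_I: "a \<in> set A \<Longrightarrow> a \<in> I"
  using A by auto

lemma e_E_mem:
  assumes "a \<in> set A"
  shows "e a * E A = (if even (length A) then - (E A * e a) else E A * e a)"
  using e_E[OF A] assms in_I by auto

lemma XL_E: "XL A * E A = (if even (length A) then - (E A * XL A) else E A * XL A)"
proof -
  have "x a * (e a * E A) = (if even (length A) then - (E A * (x a * e a)) else E A * (x a * e a))"
    if "a \<in> set A" for a
    using that in_I A x_E[of A a] x_E[of A a] by (simp add: e_E_mem flip: mult.assoc)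
  then show ?thesis
    unfolding XL_def sum_distrib_left sum_distrib_right mult.assoc
    by (auto simp flip: sum_negf intro!: sum.cong)
qed

lemma DL_E: "DL A * E A = (if even (length A) then - (E A * DL A) else E A * DL A)"
proof -
  have "p a * (e a * E A) = (if even (length A) then - (E A * (p a * e a)) else E A * (p a * e a))"
    if "a \<in> set A" for a
    using that in_I A p_E[of A a] by (simp add: e_E_mem flip: mult.assoc)
  then show ?thesis
    unfolding DL_def sum_distrib_left sum_distrib_right mult.assoc
    by (auto simp flip: sum_negf intro!: sum.cong)
qed

text \<open>Both factors contribute a sign depending on the parity of \<open>length A\<close>. The
  two signs agree if \<open>i\<close> is in \<open>A\<close> and differ otherwise, so the parity
  itself drops out.\<close>

lemma E_e_e:
  assumes "i \<in> I" "j \<in> set A"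
  shows "E A * (e j * e i) = (if i \<in> set A then e j * (e i * E A) else - (e j * (e i * E A)))"
  using e_E[OF A assms(1)] e_E_mem[OF assms(2)]
  by (auto simp flip: mult.assoc split: if_splits)

section \<open>Comparison of the three forms, summand by summand\<close>

lemma normal_left:
  assumes "i \<in> I" "j \<in> I"
  shows "e i * p i * (x j * e j) * E A = e i * e j * (p i * x j) * E A"
    and "e i * x i * (p j * e j) * E A = e i * e j * (x i * p j) * E A"
    using assms by (simp_all add: mult.assoc x_e p_e x_e' p_e')

lemma normal_right:
  assumes "i \<in> I" "j \<in> set A"
  shows "E A * (x j * e j) * (e i * p i) =
      (if i \<in> set A then e j * e i * (x j * p i) * E A else - (e j * e i * (x j * p i) * E A))"
    and "E A * (p j * e j) * (e i * x i) =
      (if i \<in> set A then e j * e i * (p j * x i) * E A else - (e j * e i * (p j * x i) * E A))"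
proof -
  have j: "j \<in> I" using assms in_I by simp
  have "E A * (x j * e j) * (e i * p i) = E A * (e j * e i) * (x j * p i)"
    "E A * (p j * e j) * (e i * x i) = E A * (e j * e i) * (p j * x i)"
    using assms(1) j by (simp_all add: mult.assoc x_e p_e x_e' p_e')
  moreover have "E A * (x j * p i) = x j * (p i * E A)" "E A * (p j * x i) = p j * (x i * E A)"
    by (metis mult.assoc x_E p_E A(2) j assms(1))+
  ultimately show "E A * (x j * e j) * (e i * p i) =
      (if i \<in> set A then e j * e i * (x j * p i) * E A else - (e j * e i * (x j * p i) * E A))"
    "E A * (p j * e j) * (e i * x i) =
      (if i \<in> set A then e j * e i * (p j * x i) * E A else - (e j * e i * (p j * x i) * E A))"
    using E_e_e[OF assms] by (simp_all add: mult.assoc)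
qed

lemma C_e_e:
  assumes "i \<in> I" "j \<in> I"
  shows "C i j * e i * e j * z = e i * e j * (p i * x j) * z - e i * e j * (x j * p i) * z"
  using assms by (simp add: C_def algebra_simps x_e' p_e' mult.assoc)

text \<open>In normal form the summands carry \<open>e i * e j\<close> with \<open>p i * x j\<close>
  and \<open>e j * e i\<close> with \<open>x j * p i\<close>. For \<open>i = j\<close> the relative
  minus sign survives, for \<open>i\<close> outside \<open>A\<close> it is changed twice (by
  \<open>E_e_e\<close> and by \<open>e_anti\<close>), and both times a commutator results. For
  \<open>i\<close> in \<open>A\<close> other than \<open>j\<close> only \<open>e_anti\<close>
  changes it, which leaves an anticommutator.\<close>

lemma first_term:
  assumes "i \<in> I" "j \<in> set A"
  shows "e i * p i * (x j * e j) * E A - E A * (x j * e j) * (e i * p i) =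
    (if i \<in> I - (set A - {j}) then C i j * e i * e j * E A
     else (e i * e j * (p i * x j) + e i * e j * (x j * p i)) * E A)"
proof -
  have j: "j \<in> I" using assms in_I by simp
  show ?thesis
    unfolding normal_left[OF assms(1) j] normal_right[OF assms] C_e_e[OF assms(1) j]
    using assms e_anti[OF assms(1) j]
    by (cases "i = j") (auto simp: distrib_right left_diff_distrib)
qed

text \<open>Here the commutator is \<open>[p j, x i]\<close>, which \<open>C_sym\<close> identifies
  with \<open>C i j\<close>. The remaining mixed term is that of \<open>first_term\<close> with
  \<open>i\<close> and \<open>j\<close> exchanged, so that one computation of the mixed sums serves
  both forms.\<close>

lemma second_term:
  assumes "i \<in> I" "j \<in> set A"
  shows "E A * (p j * e j) * (e i * x i) - e i * x i * (p j * e j) * E A =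
    (if i \<in> I - (set A - {j}) then C i j * e i * e j * E A
     else (e j * e i * (p j * x i) + e j * e i * (x i * p j)) * E A)"
proof -
  have j: "j \<in> I" using assms in_I by simp
  have C: "C i j * e i * e j * E A = e i * e j * (p j * x i) * E A - e i * e j * (x i * p j) * E A"
    using assms(1) j by (simp add: C_sym[OF assms(1) j]) (simp add: C_def algebra_simps x_e' p_e' mult.assoc)
  show ?thesis
    unfolding normal_left[OF assms(1) j] normal_right[OF assms] C
    using assms e_anti[OF assms(1) j]
    by (cases "i = j") (auto simp: distrib_right left_diff_distrib)
qed

text \<open>Writing each \<open>p * x\<close> as \<open>C\<close> plus \<open>x * p\<close> leaves
  \<open>C i j\<close> once with \<open>e i * e j\<close> and once with \<open>e j * e i\<close>. By
  symmetry of \<open>C\<close> these cancel, and the doubled \<open>x * p\<close> terms form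
  \<open>L i j\<close>.\<close>

lemma mixed_pair:
  assumes "i \<in> I" "j \<in> I" "i \<noteq> j"
  shows "(e i * e j * (p i * x j) + e i * e j * (x j * p i)) +
      (e j * e i * (p j * x i) + e j * e i * (x i * p j)) = - (L i j * e i * e j + L i j * e i * e j)"
proof -
  have px: "p i * x j = C i j + x j * p i" "p j * x i = C i j + x i * p j"
    by (simp add: C_def) (simp add: C_sym[OF assms(1,2)], simp add: C_def)
  have L: "L i j * e i * e j = e i * e j * (x i * p j) - e i * e j * (x j * p i)"
    using assms by (simp add: L_def algebra_simps x_e' p_e' x_e p_e)
  show ?thesis
    unfolding px L e_anti[OF assms] by (simp add: algebra_simps)
qed

lemma split_sum:
  "(\<Sum>j\<in>set A. \<Sum>i\<in>I. if i \<in> I - (set A - {j}) then f i j else g i j) =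
    (\<Sum>j\<in>set A. \<Sum>i\<in>I - (set A - {j}). f i j) + (\<Sum>j\<in>set A. \<Sum>i\<in>set A - {j}. g i j)"
proof -
  have "(\<Sum>i\<in>I. if i \<in> I - (set A - {j}) then f i j else g i j) =
      (\<Sum>i\<in>I - (set A - {j}). f i j) + (\<Sum>i\<in>set A - {j}. g i j)" for j
  proof -
    have "I = (I - (set A - {j})) \<union> (set A - {j})" using A by auto
    then have "(\<Sum>i\<in>I. if i \<in> I - (set A - {j}) then f i j else g i j) =
       (\<Sum>i\<in>(I - (set A - {j})) \<union> (set A - {j}). if i \<in> I - (set A - {j}) then f i j else g i j)"
      by simp
    also have "\<dots> = (\<Sum>i\<in>I - (set A - {j}). f i j) + (\<Sum>i\<in>set A - {j}. g i j)"
      by (subst sum.union_disjoint) (use finite_I in auto)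
    finally show ?thesis .
  qed
  then show ?thesis by (simp add: sum.distrib)
qed

lemma mixed_sum:
  "(\<Sum>j\<in>set A. \<Sum>i\<in>set A - {j}. e i * e j * (p i * x j) + e i * e j * (x j * p i)) = - LS A"
  "(\<Sum>j\<in>set A. \<Sum>i\<in>set A - {j}. e j * e i * (p j * x i) + e j * e i * (x i * p j)) = - LS A"
proof -
  have "(e i * e j * (p i * x j) + e i * e j * (x j * p i)) +
      (e j * e i * (p j * x i) + e j * e i * (x i * p j)) = - (L i j * e i * e j + L i j * e i * e j)"
    if "i \<in> set A" "j \<in> set A" "i < j" for i j
    using that by (intro mixed_pair) (auto simp: in_I)
  then show "(\<Sum>j\<in>set A. \<Sum>i\<in>set A - {j}. e i * e j * (p i * x j) + e i * e j * (x j * p i)) = - LS A"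
    "(\<Sum>j\<in>set A. \<Sum>i\<in>set A - {j}. e j * e i * (p j * x i) + e j * e i * (x i * p j)) = - LS A"
    \<comment> \<open>Both double sums reduce to the same unordered pairs; they differ only by
      exchanging the two summands of each pair.\<close>
    unfolding sum_distinct_pairs[OF finite_set] LS_def sum_negf[symmetric]
    by (intro sum.cong; force simp: add_ac)+
qed

text \<open>The term \<open>- q * E A\<close> is common to all forms and is left out. The double sum
  is arranged with \<open>j\<close> in \<open>A\<close> outside, as in \<open>CS\<close>, so that
  \<open>first_term\<close> applies summand by summand.\<close>

lemma first_eq_third: "DD * XL A * E A - E A * XL A * DD = (CS A - LS A) * E A"
proof -
  have "DD * XL A * E A = (\<Sum>j\<in>set A. \<Sum>i\<in>I. e i * p i * (x j * e j) * E A)"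
    unfolding DD_def XL_def sum_product by (subst sum.swap) (simp only: sum_distrib_right)
  moreover have "E A * XL A * DD = (\<Sum>j\<in>set A. \<Sum>i\<in>I. E A * (x j * e j) * (e i * p i))"
    unfolding DD_def XL_def sum_distrib_left sum_distrib_right by (rule sum.swap)
  ultimately have "DD * XL A * E A - E A * XL A * DD =
      (\<Sum>j\<in>set A. \<Sum>i\<in>I. e i * p i * (x j * e j) * E A - E A * (x j * e j) * (e i * p i))"
    by (simp add: sum_subtractf)
  also have "\<dots> = (\<Sum>j\<in>set A. \<Sum>i\<in>I. if i \<in> I - (set A - {j}) then C i j * e i * e j * E A
     else (e i * e j * (p i * x j) + e i * e j * (x j * p i)) * E A)"
    by (intro sum.cong refl first_term)
  also have "\<dots> = CS A * E A + (\<Sum>j\<in>set A. \<Sum>i\<in>set A - {j}. e i * e j * (p i * x j) + e i * e j * (x j * p i)) * E A"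
    unfolding split_sum CS_def sum_distrib_right by (rule refl)
  finally show ?thesis
    unfolding mixed_sum by (simp add: algebra_simps)
qed

lemma second_eq_third: "E A * DL A * XX - XX * DL A * E A = (CS A - LS A) * E A"
proof -
  have "XX * DL A * E A = (\<Sum>j\<in>set A. \<Sum>i\<in>I. e i * x i * (p j * e j) * E A)"
    unfolding XX_def DL_def sum_product by (subst sum.swap) (simp only: sum_distrib_right)
  moreover have "E A * DL A * XX = (\<Sum>j\<in>set A. \<Sum>i\<in>I. E A * (p j * e j) * (e i * x i))"
    unfolding XX_def DL_def sum_distrib_left sum_distrib_right by (rule sum.swap)
  ultimately have "E A * DL A * XX - XX * DL A * E A =
      (\<Sum>j\<in>set A. \<Sum>i\<in>I. E A * (p j * e j) * (e i * x i) - e i * x i * (p j * e j) * E A)"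
    by (simp add: sum_subtractf)
  also have "\<dots> = (\<Sum>j\<in>set A. \<Sum>i\<in>I. if i \<in> I - (set A - {j}) then C i j * e i * e j * E A
     else (e j * e i * (p j * x i) + e j * e i * (x i * p j)) * E A)"
    by (intro sum.cong refl second_term)
  also have "\<dots> = CS A * E A + (\<Sum>j\<in>set A. \<Sum>i\<in>set A - {j}. e j * e i * (p j * x i) + e j * e i * (x i * p j)) * E A"
    unfolding split_sum CS_def sum_distrib_right by (rule refl)
  finally show ?thesis
    unfolding mixed_sum by (simp add: algebra_simps)
qed

section \<open>Graded commutation with \<open>DD\<close> and \<open>XX\<close>\<close>

lemma vector_E:
  assumes y_e: "\<And>i j. \<lbrakk>i \<in> I; j \<in> I\<rbrakk> \<Longrightarrow> y i * e j = e j * y i"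
    and y_E: "\<And>i. i \<in> I \<Longrightarrow> y i * E A = E A * y i"
  shows "(\<Sum>i\<in>I. e i * y i) * E A =
    (if even (length A) then E A * (\<Sum>i\<in>I. e i * y i) + (\<Sum>a\<in>set A. y a * e a) * E A + (\<Sum>a\<in>set A. y a * e a) * E A
     else - (E A * (\<Sum>i\<in>I. e i * y i)) + (\<Sum>a\<in>set A. y a * e a) * E A + (\<Sum>a\<in>set A. y a * e a) * E A)"
    (is "?l = ?r")
proof -
  let ?s = "\<lambda>z. if even (length A) then z else - z"
  have split: "(\<Sum>i\<in>I. f i) = (\<Sum>i\<in>I - set A. f i) + (\<Sum>i\<in>set A. f i)" for f :: "nat \<Rightarrow> 'r"
    using finite_I A(2) by (metis sum.subset_diff)
  have s: "?s (\<Sum>i\<in>J. f i) = (\<Sum>i\<in>J. ?s (f i))" for f :: "nat \<Rightarrow> 'r" and J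
    by (simp add: sum_negf)
  have outside: "e i * y i * E A = ?s (E A * (e i * y i))" if "i \<in> I - set A" for i
    using that e_E[OF A, of i] y_E[of i] by (simp add: mult.assoc) (simp flip: mult.assoc)
  \<comment> \<open>Inside \<open>A\<close> the sign is opposite to the expected one; adding
    \<open>y i * e i * E A\<close> twice makes up for it. These corrections build the vector
    supported on \<open>A\<close>.\<close>
  have inside: "e i * y i * E A = ?s (E A * (e i * y i)) + y i * e i * E A + y i * e i * E A"
    if "i \<in> set A" for i
  proof -
    have "E A * (e i * y i) = - ?s (e i * y i * E A)"
      using that e_E_mem[OF that] y_E[of i] in_I[OF that]
      by (simp add: mult.assoc) (simp flip: mult.assoc)
    then show ?thesis
      using that in_I y_e[of i i] by (simp split: if_splits)
  qed
  have "?l = (\<Sum>i\<in>I. e i * y i * E A)"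
    by (simp add: sum_distrib_right)
  also have "\<dots> = (\<Sum>i\<in>I - set A. ?s (E A * (e i * y i))) +
      (\<Sum>i\<in>set A. ?s (E A * (e i * y i)) + y i * e i * E A + y i * e i * E A)"
    unfolding split by (intro arg_cong2[of _ _ _ _ "(+)"] sum.cong refl outside inside)
  also have "\<dots> = ?s (E A * (\<Sum>i\<in>I. e i * y i)) + (\<Sum>i\<in>set A. y i * e i * E A) + (\<Sum>i\<in>set A. y i * e i * E A)"
    unfolding sum_distrib_left s split[of "\<lambda>i. ?s (E A * (e i * y i))"] by (simp only: sum.distrib add_ac)
  finally show ?thesis
    by (simp add: sum_distrib_right split: if_splits)
qed

lemma DD_E: "DD * E A = (if even (length A) then E A * DD + DL A * E A + DL A * E A
     else - (E A * DD) + DL A * E A + DL A * E A)"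
  unfolding DD_def DL_def by (rule vector_E; fact p_e p_E[OF A(2)])

lemma XX_E: "XX * E A = (if even (length A) then E A * XX + XL A * E A + XL A * E A
     else - (E A * XX) + XL A * E A + XL A * E A)"
  unfolding XX_def XL_def by (rule vector_E; fact x_e x_E[OF A(2)])

text \<open>Covers both directions: \<open>(y, z, v)\<close> is \<open>(p, x, p)\<close> for
  \<open>DD\<close> and \<open>(x, p, - x)\<close> for \<open>XX\<close>. The sum of squares
  commutes with every \<open>e a\<close>, and \<open>q\<close> commutes with \<open>e a\<close> and
  \<open>z a\<close>, so the commutator acts on the factor \<open>z a\<close> alone.\<close>

lemma square_vector:
  assumes y_e: "\<And>i j. \<lbrakk>i \<in> I; j \<in> I\<rbrakk> \<Longrightarrow> y i * e j = e j * y i"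
    and y_E: "\<And>i. i \<in> I \<Longrightarrow> y i * E A = E A * y i"
    and q_z: "\<And>i. i \<in> I \<Longrightarrow> q * z i = z i * q"
    and z: "\<And>j. j \<in> I \<Longrightarrow> (\<Sum>i\<in>I. y i * y i) * z j - z j * (\<Sum>i\<in>I. y i * y i) = v j + v j"
  shows "q * (\<Sum>i\<in>I. y i * y i) * (\<Sum>a\<in>set A. z a * e a) -
      (\<Sum>a\<in>set A. z a * e a) * (q * (\<Sum>i\<in>I. y i * y i)) =
      q * ((\<Sum>a\<in>set A. v a * e a) + (\<Sum>a\<in>set A. v a * e a))"
    and "I \<noteq> {} \<Longrightarrow> q * (\<Sum>i\<in>I. y i * y i) * E A = E A * (q * (\<Sum>i\<in>I. y i * y i))"
proof -
  let ?P = "\<Sum>i\<in>I. y i * y i"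
  have P_e: "e j * ?P = ?P * e j" if "j \<in> I" for j
    unfolding sum_distrib_left sum_distrib_right
    using that by (intro sum.cong refl) (metis mult.assoc y_e)
  have P_E: "E A * ?P = ?P * E A"
    unfolding sum_distrib_left sum_distrib_right by (intro sum.cong refl) (metis mult.assoc y_E)
  have summand: "q * ?P * (z a * e a) - z a * e a * (q * ?P) = q * (v a * e a) + q * (v a * e a)"
    if "a \<in> set A" for a
  proof -
    have a: "a \<in> I" using that by (rule in_I)
    have "z a * e a * (q * ?P) = z a * (e a * q) * ?P"
      by (simp add: mult.assoc)
    also have "\<dots> = (z a * q) * e a * ?P"
      unfolding q_e[OF a a, symmetric] by (simp add: mult.assoc)
    also have "\<dots> = q * (z a * (e a * ?P))"
      unfolding q_z[OF a, symmetric] by (simp add: mult.assoc)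
    finally have "z a * e a * (q * ?P) = q * (z a * ?P) * e a"
      by (simp add: P_e[OF a] mult.assoc)
    then have "q * ?P * (z a * e a) - z a * e a * (q * ?P) = q * (?P * z a - z a * ?P) * e a"
      by (simp add: algebra_simps)
    then show ?thesis
      by (simp only: z[OF a]) (simp add: algebra_simps)
  qed
  define P where "P = ?P"
  show "q * ?P * (\<Sum>a\<in>set A. z a * e a) - (\<Sum>a\<in>set A. z a * e a) * (q * ?P) =
      q * ((\<Sum>a\<in>set A. v a * e a) + (\<Sum>a\<in>set A. v a * e a))"
    unfolding P_def[symmetric] sum_distrib_left[of "q * P"] sum_distrib_right[of _ _ "q * P"]
      distrib_left[of q] sum_distrib_left[of q] sum_subtractf[symmetric] sum.distrib[symmetric]
    by (intro sum.cong refl summand[folded P_def])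
  show "q * ?P * E A = E A * (q * ?P)" if nonempty: "I \<noteq> {}"
  proof -
    \<comment> \<open>Some index is required to recognise \<open>q\<close> as a square of a
      generator and hence to move it past \<open>E A\<close>.\<close>
    obtain i where "i \<in> I" using nonempty by auto
    then have "E A * q = q * E A" by (rule q_E[OF A(2), symmetric])
    have "E A * (q * ?P) = q * (E A * ?P)"
      unfolding mult.assoc[symmetric] \<open>E A * q = q * E A\<close> by (rule refl)
    then show ?thesis by (simp only: P_E mult.assoc)
  qed
qed

lemma q_commute: "DD * q = q * DD" "XX * q = q * XX"
  unfolding DD_def XX_def sum_distrib_left sum_distrib_right
  by (intro sum.cong refl; metis mult.assoc q_e q_p q_x)+

text \<open>\<open>W\<close> represents \<open>2 O_A\<close> in its first form, which is the one
  suited to \<open>DD\<close>: multiplication by \<open>DD\<close> from the left creates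
  \<open>DD * DD\<close>, whose commutators are known.\<close>

lemma DD_first:
  defines "W \<equiv> DD * XL A * E A - E A * XL A * DD - q * E A"
  shows "DD * W = (if even (length A) then W * DD else - (W * DD))"
proof (cases "I = {}")
  case True
  then have "DD = 0" unfolding DD_def by simp
  then show ?thesis by simp
next
  case False
  have x: "(\<Sum>i\<in>I. p i * p i) * x j - x j * (\<Sum>i\<in>I. p i * p i) = p j + p j" if "j \<in> I" for j
    unfolding \<Delta>_x[OF that, symmetric] by (simp add: algebra_simps flip: \<Delta>)
  have "DD * DD * XL A - XL A * (DD * DD) = q * (DL A + DL A)"
    unfolding DD_square \<Delta> XL_def DL_def
    by (rule square_vector; fact p_e p_E[OF A(2)] q_x x)
  moreover have "DD * DD * E A = E A * (DD * DD)"
    unfolding DD_square \<Delta>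
    by (rule square_vector; fact p_e p_E[OF A(2)] q_x x False)
  ultimately show ?thesis
    unfolding W_def by (rule graded_commute[OF XL_E DD_E _ _ q_commute(1)])
qed

lemma XX_second:
  defines "W \<equiv> E A * DL A * XX - XX * DL A * E A - q * E A"
  shows "XX * W = (if even (length A) then W * XX else - (W * XX))"
proof (cases "I = {}")
  case True
  then have "XX = 0" unfolding XX_def by simp
  then show ?thesis by simp
next
  case False
  have p: "(\<Sum>i\<in>I. x i * x i) * p j - p j * (\<Sum>i\<in>I. x i * x i) = - x j + - x j" if "j \<in> I" for j
    unfolding \<rho>_p[OF that, symmetric] by (simp add: algebra_simps flip: \<rho>)
  have "XX * XX * DL A - DL A * (XX * XX) = q * ((\<Sum>a\<in>set A. - x a * e a) + (\<Sum>a\<in>set A. - x a * e a))"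
    unfolding XX_square \<rho> DL_def
    by (rule square_vector; fact x_e x_E[OF A(2)] q_p p)
  then have XXX: "XX * XX * DL A - DL A * (XX * XX) = - q * (XL A + XL A)"
    by (simp add: XL_def sum_negf algebra_simps)
  have XXE: "XX * XX * E A = E A * (XX * XX)"
    unfolding XX_square \<rho>
    by (rule square_vector; fact x_e x_E[OF A(2)] q_p p False)
  \<comment> \<open>The relation for \<open>\<rho>\<close> has the opposite sign, so the abstract
    lemma is used with \<open>r = - q\<close>; the element it produces is then
    \<open>- W\<close>.\<close>
  from graded_commute[OF DL_E XX_E XXX XXE]
  have "XX * - W = (if even (length A) then - W * XX else - (- W * XX))"
    unfolding W_def using q_commute(2) by (simp add: algebra_simps)
  then show ?thesis
    by (auto split: if_splits simp: neg_eq_iff_add_eq_0 add_eq_0_iff2)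
qed

end

end

section \<open>The product of all rings with carrier sets\<close>

text \<open>A record of the right type need not be a ring. Such records are replaced by the
  one-element ring, so that every factor of the product is a ring.\<close>

definition ring_or_trivial :: "('a, 'b) ring_scheme \<Rightarrow> ('a, 'b) ring_scheme" where
  "ring_or_trivial R = (if ring R then R else
    R\<lparr>carrier := {undefined}, mult := \<lambda>_ _. undefined, one := undefined,
      zero := undefined, add := \<lambda>_ _. undefined\<rparr>)"

lemma ring_ring_or_trivial: "ring (ring_or_trivial R)"
proof (cases "ring R")
  case False
  then show ?thesis
    unfolding ring_or_trivial_def by (intro ringI abelian_groupI monoidI) (auto simp: simp_thms)
qed (simp add: ring_or_trivial_def)

lemmas ring_or_trivial_simprules = ring.ring_simprules[OF ring_ring_or_trivial]

text \<open>The index set consists of all ring records over the given types, so the type mentions no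
  particular ring.\<close>

typedef ('a, 'b) ring_product =
  "{f :: ('a, 'b) ring_scheme \<Rightarrow> 'a. \<forall>R. f R \<in> carrier (ring_or_trivial R)}"
  by (rule exI[of _ "\<lambda>R. \<zero>\<^bsub>ring_or_trivial R\<^esub>"]) (simp add: ring_or_trivial_simprules)

setup_lifting type_definition_ring_product

instantiation ring_product :: (type, type) ring
begin

lift_definition zero_ring_product :: "('a, 'b) ring_product"
  is "\<lambda>R. \<zero>\<^bsub>ring_or_trivial R\<^esub>" by (simp add: ring_or_trivial_simprules)

lift_definition plus_ring_product ::
    "('a, 'b) ring_product \<Rightarrow> ('a, 'b) ring_product \<Rightarrow> ('a, 'b) ring_product"
  is "\<lambda>f g R. f R \<oplus>\<^bsub>ring_or_trivial R\<^esub> g R" by (simp add: ring_or_trivial_simprules)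

lift_definition uminus_ring_product :: "('a, 'b) ring_product \<Rightarrow> ('a, 'b) ring_product"
  is "\<lambda>f R. \<ominus>\<^bsub>ring_or_trivial R\<^esub> f R" by (simp add: ring_or_trivial_simprules)

lift_definition minus_ring_product ::
    "('a, 'b) ring_product \<Rightarrow> ('a, 'b) ring_product \<Rightarrow> ('a, 'b) ring_product"
  is "\<lambda>f g R. f R \<ominus>\<^bsub>ring_or_trivial R\<^esub> g R" by (simp add: ring_or_trivial_simprules)

lift_definition times_ring_product ::
    "('a, 'b) ring_product \<Rightarrow> ('a, 'b) ring_product \<Rightarrow> ('a, 'b) ring_product"
  is "\<lambda>f g R. f R \<otimes>\<^bsub>ring_or_trivial R\<^esub> g R" by (simp add: ring_or_trivial_simprules)

instance
  by (standard; transfer) (simp_all add: ring_or_trivial_simprules fun_eq_iff)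

end

text \<open>The factor belonging to \<open>R\<close> receives \<open>a\<close>, all others receive
  zero; this preserves sums and products but sends one to an idempotent. Arguments outside the
  carrier are sent to zero to make the map total.\<close>

lift_definition coordinate :: "('a, 'b) ring_scheme \<Rightarrow> 'a \<Rightarrow> ('a, 'b) ring_product"
  is "\<lambda>R a S. if S = R \<and> a \<in> carrier (ring_or_trivial R) then a else \<zero>\<^bsub>ring_or_trivial S\<^esub>"
  by (simp add: ring_or_trivial_simprules)

context ring
begin

lemma ring_or_trivial_eq: "ring_or_trivial R = R"
  by (simp add: ring_or_trivial_def ring_axioms)

text \<open>Evaluation at the index \<open>R\<close> recovers the element; this pulls identities
  back from the product to \<open>R\<close>.\<close>

lemma coordinate_inject:
  assumes "a \<in> carrier R" "b \<in> carrier R"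
  shows "coordinate R a = coordinate R b \<longleftrightarrow> a = b"
proof
  assume "coordinate R a = coordinate R b"
  then have "Rep_ring_product (coordinate R a) R = Rep_ring_product (coordinate R b) R"
    by simp
  then show "a = b"
    using assms by (simp add: coordinate.rep_eq ring_or_trivial_eq)
qed simp

lemma coordinate_zero: "coordinate R \<zero> = 0"
  by (transfer fixing: R) (auto simp: ring_or_trivial_eq)

lemma coordinate_add:
  assumes "a \<in> carrier R" "b \<in> carrier R"
  shows "coordinate R (a \<oplus> b) = coordinate R a + coordinate R b"
  using assms
  by (transfer fixing: R) (auto simp: fun_eq_iff ring_or_trivial_eq ring_or_trivial_simprules)

lemma coordinate_mult:
  assumes "a \<in> carrier R" "b \<in> carrier R"
  shows "coordinate R (a \<otimes> b) = coordinate R a * coordinate R b"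
  using assms
  by (transfer fixing: R) (auto simp: fun_eq_iff ring_or_trivial_eq ring_or_trivial_simprules)

lemma coordinate_uminus:
  assumes "a \<in> carrier R"
  shows "coordinate R (\<ominus> a) = - coordinate R a"
  using assms
  by (transfer fixing: R) (auto simp: fun_eq_iff ring_or_trivial_eq ring_or_trivial_simprules)

lemma coordinate_minus:
  assumes "a \<in> carrier R" "b \<in> carrier R"
  shows "coordinate R (a \<ominus> b) = coordinate R a - coordinate R b"
  using assms by (simp add: minus_eq coordinate_add coordinate_uminus)

lemma coordinate_finsum:
  assumes "finite A" "f \<in> A \<rightarrow> carrier R"
  shows "coordinate R (finsum R f A) = (\<Sum>i\<in>A. coordinate R (f i))"
  using assms
proof (induction A)
  case empty
  then show ?case by (simp add: coordinate_zero)
next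
  case (insert a A)
  then have "f a \<in> carrier R" "f \<in> A \<rightarrow> carrier R" by auto
  then show ?case
    using insert by (simp add: coordinate_add)
qed

end

section \<open>Associative algebras\<close>

locale assoc_algebra = ring A for A :: "('k::field, 'a) module" (structure) +
  assumes smult_closed [simp, intro]: "a \<in> carrier A \<Longrightarrow> c \<odot> a \<in> carrier A"
    and smult_l_distr: "a \<in> carrier A \<Longrightarrow> (c + d) \<odot> a = c \<odot> a \<oplus> d \<odot> a"
    and smult_r_distr: "\<lbrakk>a \<in> carrier A; b \<in> carrier A\<rbrakk> \<Longrightarrow> c \<odot> (a \<oplus> b) = c \<odot> a \<oplus> c \<odot> b"
    and smult_assoc: "a \<in> carrier A \<Longrightarrow> (c * d) \<odot> a = c \<odot> (d \<odot> a)"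
    and smult_one: "a \<in> carrier A \<Longrightarrow> 1 \<odot> a = a"
    and smult_mult_left: "\<lbrakk>a \<in> carrier A; b \<in> carrier A\<rbrakk> \<Longrightarrow> (c \<odot> a) \<otimes> b = c \<odot> (a \<otimes> b)"
    and smult_mult_right: "\<lbrakk>a \<in> carrier A; b \<in> carrier A\<rbrakk> \<Longrightarrow> a \<otimes> (c \<odot> b) = c \<odot> (a \<otimes> b)"

definition algebra_hom :: "('k, 'a) module \<Rightarrow> ('k, 'b) module \<Rightarrow> ('a \<Rightarrow> 'b) \<Rightarrow> bool" where
  "algebra_hom A B h \<longleftrightarrow> h \<in> ring_hom A B \<and>
    (\<forall>c. \<forall>a\<in>carrier A. h (c \<odot>\<^bsub>A\<^esub> a) = c \<odot>\<^bsub>B\<^esub> h a)"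

lemma algebra_hom_comp:
  assumes "algebra_hom A B g" "algebra_hom B C h"
  shows "algebra_hom A C (h \<circ> g)"
  using assms ring_hom_trans[of g A B h C] ring_hom_closed[of g A B]
  by (auto simp: algebra_hom_def)

section \<open>Monoid algebras\<close>

lemma lookup_map_mult: "Poly_Mapping.lookup (Poly_Mapping.map ((*) c) f) u = c * Poly_Mapping.lookup f u"
  for c :: "'k::field"
  by (simp add: Poly_Mapping.map.rep_eq when_def)

lemma map_mult_add: "Poly_Mapping.map ((*) c) (f + g) = Poly_Mapping.map ((*) c) f + Poly_Mapping.map ((*) c) g"
  for c :: "'k::field"
  by (rule poly_mapping_eqI) (simp add: lookup_map_mult lookup_add algebra_simps)

lemma map_mult_single: "Poly_Mapping.map ((*) c) (Poly_Mapping.single u a) = Poly_Mapping.single u (c * a)"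
  for c :: "'k::field"
  by (rule poly_mapping_eqI) (simp add: lookup_map_mult lookup_single when_def)

lemma map_mult_zero: "Poly_Mapping.map ((*) c) 0 = 0"
  for c :: "'k::field"
  by (rule poly_mapping_eqI) (simp add: lookup_map_mult)

text \<open>Reduces a law that is additive in \<open>f\<close> to single terms with basis element in
  \<open>X\<close>, where the monoid laws are available.\<close>

lemma poly_mapping_carrier_induct [consumes 1, case_names zero add]:
  fixes f :: "'m \<Rightarrow>\<^sub>0 'k::comm_monoid_add"
  assumes "Poly_Mapping.keys f \<subseteq> X"
    and zero: "P 0"
    and add: "\<And>u a f. \<lbrakk>u \<in> X; P f\<rbrakk> \<Longrightarrow> P (Poly_Mapping.single u a + f)"
  shows "P f"
proof -
  have "P (\<Sum>u\<in>U. Poly_Mapping.single u (Poly_Mapping.lookup f u))" if "finite U" "U \<subseteq> X" for U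
    using that by (induction U) (auto intro: zero add)
  moreover have "f = (\<Sum>u\<in>Poly_Mapping.keys f. Poly_Mapping.single u (Poly_Mapping.lookup f u))"
    by (rule poly_mapping_eqI)
      (auto simp: lookup_sum lookup_single when_def in_keys_iff)
  ultimately show ?thesis
    using assms(1) by (metis finite_keys)
qed

text \<open>The product is a sum over supports, and the support of \<open>f + g\<close> may shrink
  by cancellation. This is harmless because a zero coefficient contributes nothing.\<close>

lemma monoid_algebra_mult:
  fixes M :: "('m, 'z) monoid_scheme"
  defines "B \<equiv> (monoid_algebra M :: ('k::field, 'm \<Rightarrow>\<^sub>0 'k) module)"
  shows monoid_algebra_mult_add_left: "(f + g) \<otimes>\<^bsub>B\<^esub> h = f \<otimes>\<^bsub>B\<^esub> h + g \<otimes>\<^bsub>B\<^esub> h"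
    and monoid_algebra_mult_add_right: "h \<otimes>\<^bsub>B\<^esub> (f + g) = h \<otimes>\<^bsub>B\<^esub> f + h \<otimes>\<^bsub>B\<^esub> g"
    and monoid_algebra_mult_zero_left: "0 \<otimes>\<^bsub>B\<^esub> h = 0"
    and monoid_algebra_mult_zero_right: "h \<otimes>\<^bsub>B\<^esub> 0 = 0"
    and monoid_algebra_mult_single: "Poly_Mapping.single u a \<otimes>\<^bsub>B\<^esub> Poly_Mapping.single v b =
      Poly_Mapping.single (u \<otimes>\<^bsub>M\<^esub> v) (a * b)"
proof -
  show "(f + g) \<otimes>\<^bsub>B\<^esub> h = f \<otimes>\<^bsub>B\<^esub> h + g \<otimes>\<^bsub>B\<^esub> h"
    unfolding B_def monoid_algebra_def monoid.simps
    by (rule setsum_keys_plus_distrib) (simp_all add: distrib_right single_add sum.distrib)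
  have "(\<Sum>v\<in>Poly_Mapping.keys (f + g). Poly_Mapping.single (u \<otimes>\<^bsub>M\<^esub> v)
      (Poly_Mapping.lookup h u * Poly_Mapping.lookup (f + g) v)) =
    (\<Sum>v\<in>Poly_Mapping.keys f. Poly_Mapping.single (u \<otimes>\<^bsub>M\<^esub> v)
      (Poly_Mapping.lookup h u * Poly_Mapping.lookup f v)) +
    (\<Sum>v\<in>Poly_Mapping.keys g. Poly_Mapping.single (u \<otimes>\<^bsub>M\<^esub> v)
      (Poly_Mapping.lookup h u * Poly_Mapping.lookup g v))" for u
    by (rule setsum_keys_plus_distrib) (simp_all add: distrib_left single_add)
  then show "h \<otimes>\<^bsub>B\<^esub> (f + g) = h \<otimes>\<^bsub>B\<^esub> f + h \<otimes>\<^bsub>B\<^esub> g"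
    by (simp add: B_def monoid_algebra_def sum.distrib)
qed (simp_all add: B_def monoid_algebra_def)

lemma monoid_algebra_simps:
  "carrier (monoid_algebra M) = {f. Poly_Mapping.keys f \<subseteq> carrier M}"
  "\<one>\<^bsub>monoid_algebra M\<^esub> = Poly_Mapping.single \<one>\<^bsub>M\<^esub> 1"
  "\<zero>\<^bsub>monoid_algebra M\<^esub> = 0"
  "f \<oplus>\<^bsub>monoid_algebra M\<^esub> g = f + g"
  "c \<odot>\<^bsub>monoid_algebra M\<^esub> f = Poly_Mapping.map ((*) c) f"
  by (simp_all add: monoid_algebra_def)

lemmas monoid_algebra_mult_simps = monoid_algebra_mult_add_left monoid_algebra_mult_add_right
  monoid_algebra_mult_zero_left monoid_algebra_mult_zero_right monoid_algebra_mult_single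

text \<open>By additivity in each argument the laws reduce to single terms, where they become the
  laws of the monoid and the field. Commutativity of the field is what moves a scalar out of the
  right factor.\<close>

lemma (in Group.monoid) monoid_algebra_assoc_algebra:
  "assoc_algebra (monoid_algebra G :: ('k::field, 'a \<Rightarrow>\<^sub>0 'k) module)"
proof -
  let ?B = "monoid_algebra G :: ('k, 'a \<Rightarrow>\<^sub>0 'k) module"
  note [simp] = monoid_algebra_mult_simps monoid_algebra_simps map_mult_add map_mult_single map_mult_zero
  have mult_keys: "Poly_Mapping.keys (f \<otimes>\<^bsub>?B\<^esub> g) \<subseteq> carrier G"
    if "Poly_Mapping.keys f \<subseteq> carrier G" "Poly_Mapping.keys g \<subseteq> carrier G" for f g
  proof -
    have "Poly_Mapping.keys (Poly_Mapping.single u a \<otimes>\<^bsub>?B\<^esub> g) \<subseteq> carrier G" if "u \<in> carrier G" for u a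
      using \<open>Poly_Mapping.keys g \<subseteq> carrier G\<close>
    proof (induction g rule: poly_mapping_carrier_induct)
      case (add v b g)
      then show ?case
        using that by (auto intro!: order_trans[OF Poly_Mapping.keys_add] split: if_splits)
    qed simp
    with that(1) show ?thesis
    proof (induction f rule: poly_mapping_carrier_induct)
      case (add u a f)
      then show ?case
        by (auto intro!: order_trans[OF Poly_Mapping.keys_add])
    qed simp
  qed
  have assoc: "f \<otimes>\<^bsub>?B\<^esub> g \<otimes>\<^bsub>?B\<^esub> h = f \<otimes>\<^bsub>?B\<^esub> (g \<otimes>\<^bsub>?B\<^esub> h)"
    if "Poly_Mapping.keys f \<subseteq> carrier G" "Poly_Mapping.keys g \<subseteq> carrier G" "Poly_Mapping.keys h \<subseteq> carrier G" for f g h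
  proof -
    have 1: "Poly_Mapping.single u a \<otimes>\<^bsub>?B\<^esub> Poly_Mapping.single v b \<otimes>\<^bsub>?B\<^esub> h =
        Poly_Mapping.single u a \<otimes>\<^bsub>?B\<^esub> (Poly_Mapping.single v b \<otimes>\<^bsub>?B\<^esub> h)"
      if "u \<in> carrier G" "v \<in> carrier G" for u a v b
      using \<open>Poly_Mapping.keys h \<subseteq> carrier G\<close> that
      by (induction h rule: poly_mapping_carrier_induct) (simp_all add: m_assoc mult.assoc)
    have 2: "Poly_Mapping.single u a \<otimes>\<^bsub>?B\<^esub> g \<otimes>\<^bsub>?B\<^esub> h =
        Poly_Mapping.single u a \<otimes>\<^bsub>?B\<^esub> (g \<otimes>\<^bsub>?B\<^esub> h)"
      if "u \<in> carrier G" for u a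
      using \<open>Poly_Mapping.keys g \<subseteq> carrier G\<close> that
      by (induction g rule: poly_mapping_carrier_induct) (simp_all add: 1 del: monoid_algebra_mult_single)
    from that(1) show ?thesis
      by (induction f rule: poly_mapping_carrier_induct) (simp_all add: 2)
  qed
  have one_left: "\<one>\<^bsub>?B\<^esub> \<otimes>\<^bsub>?B\<^esub> f = f" and one_right: "f \<otimes>\<^bsub>?B\<^esub> \<one>\<^bsub>?B\<^esub> = f"
    if "Poly_Mapping.keys f \<subseteq> carrier G" for f
    using that by (induction f rule: poly_mapping_carrier_induct) simp_all
  have smult_mult: "(Poly_Mapping.map ((*) c) f) \<otimes>\<^bsub>?B\<^esub> g = Poly_Mapping.map ((*) c) (f \<otimes>\<^bsub>?B\<^esub> g)"
    "f \<otimes>\<^bsub>?B\<^esub> (Poly_Mapping.map ((*) c) g) = Poly_Mapping.map ((*) c) (f \<otimes>\<^bsub>?B\<^esub> g)" for f g and c :: 'k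
  proof -
    have 1: "(Poly_Mapping.map ((*) c) (Poly_Mapping.single u a)) \<otimes>\<^bsub>?B\<^esub> g =
        Poly_Mapping.map ((*) c) (Poly_Mapping.single u a \<otimes>\<^bsub>?B\<^esub> g)"
      "Poly_Mapping.single u a \<otimes>\<^bsub>?B\<^esub> (Poly_Mapping.map ((*) c) g) =
        Poly_Mapping.map ((*) c) (Poly_Mapping.single u a \<otimes>\<^bsub>?B\<^esub> g)" for u a
      by (rule poly_mapping_carrier_induct[OF subset_UNIV, of _ g]; simp add: mult.assoc mult.left_commute)+
    show "(Poly_Mapping.map ((*) c) f) \<otimes>\<^bsub>?B\<^esub> g = Poly_Mapping.map ((*) c) (f \<otimes>\<^bsub>?B\<^esub> g)"
      by (rule poly_mapping_carrier_induct[OF subset_UNIV, of _ f]) (simp_all add: 1 del: map_mult_single, simp_all add: 1(1)[simplified])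
    show "f \<otimes>\<^bsub>?B\<^esub> (Poly_Mapping.map ((*) c) g) = Poly_Mapping.map ((*) c) (f \<otimes>\<^bsub>?B\<^esub> g)"
      by (rule poly_mapping_carrier_induct[OF subset_UNIV, of _ f]) (simp_all add: 1)
  qed
  have "ring ?B"
  proof (intro ringI abelian_groupI monoidI)
    fix f assume "f \<in> carrier ?B"
    then show "\<exists>g\<in>carrier ?B. g \<oplus>\<^bsub>?B\<^esub> f = \<zero>\<^bsub>?B\<^esub>"
      by (intro bexI[of _ "- f"]) simp_all
  qed (use mult_keys assoc one_left one_right in
      \<open>auto intro!: order_trans[OF Poly_Mapping.keys_add] simp: add_ac simp del: monoid_algebra_simps(2)\<close>, simp_all)
  then show ?thesis
  proof (intro assoc_algebra.intro assoc_algebra_axioms.intro)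
    fix c d :: 'k and f assume "f \<in> carrier ?B"
    then show "c \<odot>\<^bsub>?B\<^esub> f \<in> carrier ?B"
      by (auto simp: in_keys_iff lookup_map_mult)
    show "(c + d) \<odot>\<^bsub>?B\<^esub> f = c \<odot>\<^bsub>?B\<^esub> f \<oplus>\<^bsub>?B\<^esub> d \<odot>\<^bsub>?B\<^esub> f" "(c * d) \<odot>\<^bsub>?B\<^esub> f = c \<odot>\<^bsub>?B\<^esub> (d \<odot>\<^bsub>?B\<^esub> f)"
      "1 \<odot>\<^bsub>?B\<^esub> f = f"
      by (auto intro!: poly_mapping_eqI simp: lookup_map_mult lookup_add algebra_simps)
  qed (simp_all add: smult_mult)
qed

text \<open>The bilinearity relations are written with the subtraction of the type, whereas cosets
  are compared with that of the record.\<close>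

lemma (in Group.monoid) monoid_algebra_minus:
  assumes "f \<in> carrier (monoid_algebra G)" "g \<in> carrier (monoid_algebra G :: ('k::field, 'a \<Rightarrow>\<^sub>0 'k) module)"
  shows "f \<ominus>\<^bsub>monoid_algebra G\<^esub> g = f - g"
proof -
  interpret B: assoc_algebra "monoid_algebra G :: ('k, 'a \<Rightarrow>\<^sub>0 'k) module"
    by (rule monoid_algebra_assoc_algebra)
  have "\<ominus>\<^bsub>monoid_algebra G\<^esub> g = - g"
    using assms(2) by (intro B.minus_equality) (simp_all add: monoid_algebra_simps)
  then show ?thesis
    by (simp add: B.minus_eq monoid_algebra_simps)
qed

lemma monoid_free_monoid: "Group.monoid (free_monoid X)"
  by (rule monoidI) (auto simp: free_monoid_def)

lemma free_algebra_assoc_algebra: "assoc_algebra (free_algebra X)"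
  unfolding free_algebra_def by (intro monoid.monoid_algebra_assoc_algebra monoid_free_monoid)

lemma free_gen_closed: "g \<in> X \<Longrightarrow> free_gen g \<in> carrier (free_algebra X)"
  by (simp add: free_algebra_def free_gen_def monoid_algebra_def free_monoid_def)

section \<open>Quotients\<close>

lemma (in assoc_algebra) alg_quot:
  assumes I: "ideal I A"
  shows alg_quot_assoc_algebra: "assoc_algebra (alg_quot A I)"
    and alg_quot_hom: "algebra_hom A (alg_quot A I) (\<lambda>a. I +> a)"
proof -
  interpret I: ideal I A by (fact I)
  interpret Q: ring "A Quot I" by (rule I.quotient_is_ring)
  let ?Q = "alg_quot A I"
  have eqs: "carrier ?Q = carrier (A Quot I)" "mult ?Q = mult (A Quot I)" "one ?Q = one (A Quot I)"
     "zero ?Q = zero (A Quot I)" "add ?Q = add (A Quot I)"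
    by (simp_all add: alg_quot_def)
  have ring: "ring ?Q"
  proof (intro ringI abelian_groupI monoidI)
    fix X assume "X \<in> carrier ?Q"
    then show "\<exists>Y\<in>carrier ?Q. Y \<oplus>\<^bsub>?Q\<^esub> X = \<zero>\<^bsub>?Q\<^esub>"
      using Q.a_inv_closed Q.l_neg by (auto simp: eqs)
  qed (simp_all add: eqs Q.ring_simprules)
  have hom: "(+>) I \<in> ring_hom A ?Q"
    using I.rcos_ring_hom by (simp add: ring_hom_def eqs)
  have smult: "c \<odot>\<^bsub>?Q\<^esub> (I +> a) = I +> (c \<odot> a)" if a: "a \<in> carrier A" for a c
  proof -
    have "I +> (c \<odot> b) = I +> (c \<odot> a)" if b: "b \<in> I +> a" for b
    proof -
      obtain i where i: "i \<in> I" "b = i \<oplus> a"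
        using b by (auto simp: a_r_coset_def r_coset_def)
      have iA: "i \<in> carrier A" using i(1) by (rule I.Icarr)
      \<comment> \<open>Multiplication by a scalar is multiplication by the ring element
        \<open>c \<odot> \<one>\<close>, so an ideal absorbs it. This makes the scalar action on
        cosets independent of the representative.\<close>
      have "c \<odot> i = (c \<odot> \<one>) \<otimes> i"
        using iA by (simp add: smult_mult_left)
      also have "\<dots> \<in> I"
        using i(1) by (intro I.I_l_closed) auto
      finally have ci: "c \<odot> i \<in> I" .
      have "c \<odot> b \<ominus> c \<odot> a = c \<odot> i"
        using iA a by (simp add: i smult_r_distr minus_eq a_assoc r_neg)
      then show ?thesis
        using ci iA a i(2) by (subst quotient_eq_iff_same_a_r_cos[OF I, symmetric]) auto
    qed
    moreover have "a \<in> I +> a"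
      using a by (rule I.a_rcos_self)
    ultimately have "(\<Union>b\<in>I +> a. I +> (c \<odot> b)) = I +> (c \<odot> a)"
      by blast
    then show ?thesis
      by (simp only: alg_quot_def module.simps)
  qed
  show "algebra_hom A ?Q (\<lambda>a. I +> a)"
    using hom smult by (simp add: algebra_hom_def)
  have coset: "\<exists>a\<in>carrier A. X = I +> a" if "X \<in> carrier ?Q" for X
    using that by (auto simp: eqs FactRing_def A_RCOSETS_def')
  note hom_rules = ring_hom_closed[OF hom] ring_hom_mult[OF hom, symmetric] ring_hom_add[OF hom, symmetric]
  show "assoc_algebra ?Q"
  proof (intro assoc_algebra.intro ring assoc_algebra_axioms.intro)
    fix X c assume "X \<in> carrier ?Q"
    then obtain a where [simp]: "a \<in> carrier A" "X = I +> a" using coset by blast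
    show "c \<odot>\<^bsub>?Q\<^esub> X \<in> carrier ?Q" "1 \<odot>\<^bsub>?Q\<^esub> X = X"
       by (simp_all add: smult smult_one hom_rules)
    fix d
    show "(c + d) \<odot>\<^bsub>?Q\<^esub> X = c \<odot>\<^bsub>?Q\<^esub> X \<oplus>\<^bsub>?Q\<^esub> d \<odot>\<^bsub>?Q\<^esub> X" "(c * d) \<odot>\<^bsub>?Q\<^esub> X = c \<odot>\<^bsub>?Q\<^esub> (d \<odot>\<^bsub>?Q\<^esub> X)"
       by (simp_all add: smult hom_rules smult_l_distr smult_assoc)
  next
    fix X Y c assume "X \<in> carrier ?Q" "Y \<in> carrier ?Q"
    then obtain a b where [simp]: "a \<in> carrier A" "X = I +> a" "b \<in> carrier A" "Y = I +> b"
      using coset by blast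
    show "c \<odot>\<^bsub>?Q\<^esub> (X \<oplus>\<^bsub>?Q\<^esub> Y) = c \<odot>\<^bsub>?Q\<^esub> X \<oplus>\<^bsub>?Q\<^esub> c \<odot>\<^bsub>?Q\<^esub> Y"
      "c \<odot>\<^bsub>?Q\<^esub> X \<otimes>\<^bsub>?Q\<^esub> Y = c \<odot>\<^bsub>?Q\<^esub> (X \<otimes>\<^bsub>?Q\<^esub> Y)" "X \<otimes>\<^bsub>?Q\<^esub> (c \<odot>\<^bsub>?Q\<^esub> Y) = c \<odot>\<^bsub>?Q\<^esub> (X \<otimes>\<^bsub>?Q\<^esub> Y)"
       by (simp_all add: smult hom_rules smult_r_distr smult_mult_left smult_mult_right)
  qed
qed

lemma (in assoc_algebra) genideal_quot_hom:
  assumes "S \<subseteq> carrier A"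
  shows genideal_quot_assoc_algebra: "assoc_algebra (alg_quot A (genideal A S))"
    and genideal_quot_algebra_hom: "algebra_hom A (alg_quot A (genideal A S)) (\<lambda>a. genideal A S +> a)"
    and genideal_quot_relation: "r \<in> S \<Longrightarrow> genideal A S +> r = \<zero>\<^bsub>alg_quot A (genideal A S)\<^esub>"
proof -
  have I: "ideal (genideal A S) A" by (rule genideal_ideal[OF assms])
  show "assoc_algebra (alg_quot A (genideal A S))"
    "algebra_hom A (alg_quot A (genideal A S)) (\<lambda>a. genideal A S +> a)"
    by (rule alg_quot_assoc_algebra[OF I] alg_quot_hom[OF I])+
  show "genideal A S +> r = \<zero>\<^bsub>alg_quot A (genideal A S)\<^esub>" if "r \<in> S"
    using a_rcos_zero[OF I] genideal_self[OF assms] that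
    by (auto simp: alg_quot_def FactRing_def)
qed

section \<open>Tensor product of two algebras\<close>

locale tensor_product = A: assoc_algebra A + B: assoc_algebra B
  for A :: "('k::field, 'a) module" and B :: "('k, 'b) module"
begin

abbreviation "M \<equiv> monoid_algebra (A \<times>\<times> B) :: ('k, 'a \<times> 'b \<Rightarrow>\<^sub>0 'k) module"

sublocale AB: Group.monoid "A \<times>\<times> B"
  by (intro DirProd_monoid A.monoid_axioms B.monoid_axioms)

sublocale M: assoc_algebra M
  by (rule AB.monoid_algebra_assoc_algebra)

lemma M_carrier: "f \<in> carrier M \<longleftrightarrow> Poly_Mapping.keys f \<subseteq> carrier A \<times> carrier B"
  by (simp add: monoid_algebra_simps)

lemma M_diff_closed: "f \<in> carrier M \<Longrightarrow> g \<in> carrier M \<Longrightarrow> f - g \<in> carrier M"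
  using AB.monoid_algebra_minus M.minus_closed by metis

lemma M_single_closed: "a \<in> carrier A \<Longrightarrow> b \<in> carrier B \<Longrightarrow> Poly_Mapping.single (a, b) k \<in> carrier M"
  by (simp add: M_carrier)

lemma relations_closed: "bilinear_relations A B \<subseteq> carrier M"
  unfolding bilinear_relations_def
  by (auto intro!: M_diff_closed M_single_closed)

abbreviation "T \<equiv> tensor_algebra A B"
abbreviation "J \<equiv> tensor_ideal A B"

lemma T_eq: "T = alg_quot M (genideal M (bilinear_relations A B))"
  by (simp add: tensor_algebra_def tensor_ideal_def)

lemma J_eq: "J = genideal M (bilinear_relations A B)"
  by (simp add: tensor_ideal_def)

sublocale T: assoc_algebra T
  unfolding T_eq by (rule M.genideal_quot_assoc_algebra[OF relations_closed])

lemma ideal_J: "ideal J M"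
  unfolding J_eq by (rule M.genideal_ideal[OF relations_closed])

lemma coset_hom: "algebra_hom M T (\<lambda>f. J +>\<^bsub>M\<^esub> f)"
  unfolding T_eq J_eq by (rule M.genideal_quot_algebra_hom[OF relations_closed])

lemma coset_ring_hom: "(\<lambda>f. J +>\<^bsub>M\<^esub> f) \<in> ring_hom M T"
  using coset_hom unfolding algebra_hom_def by (rule conjunct1)

lemma coset_smult: "f \<in> carrier M \<Longrightarrow> J +>\<^bsub>M\<^esub> (k \<odot>\<^bsub>M\<^esub> f) = k \<odot>\<^bsub>T\<^esub> (J +>\<^bsub>M\<^esub> f)"
  using coset_hom unfolding algebra_hom_def by blast

lemma coset_eq:
  assumes "f \<in> carrier M" "g \<in> carrier M" "f - g \<in> bilinear_relations A B"
  shows "J +>\<^bsub>M\<^esub> f = J +>\<^bsub>M\<^esub> g"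
proof -
  have "f - g \<in> J"
    using assms(3) M.genideal_self[OF relations_closed] by (auto simp: J_eq)
  then show ?thesis
    using M.quotient_eq_iff_same_a_r_cos[OF ideal_J assms(1,2)]
    by (simp add: AB.monoid_algebra_minus assms)
qed

lemma pure_tensor_closed: "a \<in> carrier A \<Longrightarrow> b \<in> carrier B \<Longrightarrow> pure_tensor A B a b \<in> carrier T"
  unfolding pure_tensor_def by (rule ring_hom_closed[OF coset_ring_hom M_single_closed])

lemma pure_tensor_mult:
  assumes "a \<in> carrier A" "b \<in> carrier B" "a' \<in> carrier A" "b' \<in> carrier B"
  shows "pure_tensor A B a b \<otimes>\<^bsub>T\<^esub> pure_tensor A B a' b' =
    pure_tensor A B (a \<otimes>\<^bsub>A\<^esub> a') (b \<otimes>\<^bsub>B\<^esub> b')"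
proof -
  show ?thesis
    using assms
    by (simp add: pure_tensor_def ring_hom_mult[OF coset_ring_hom, symmetric] M_single_closed monoid_algebra_mult_single)
qed

lemma pure_tensor_one: "pure_tensor A B \<one>\<^bsub>A\<^esub> \<one>\<^bsub>B\<^esub> = \<one>\<^bsub>T\<^esub>"
proof -
  show ?thesis
    using ring_hom_one[OF coset_ring_hom] by (simp add: pure_tensor_def monoid_algebra_simps)
qed

lemma pure_tensor_add:
  assumes "a \<in> carrier A" "b \<in> carrier B" "a' \<in> carrier A" "b' \<in> carrier B"
  shows "pure_tensor A B (a \<oplus>\<^bsub>A\<^esub> a') b = pure_tensor A B a b \<oplus>\<^bsub>T\<^esub> pure_tensor A B a' b"
    and "pure_tensor A B a (b \<oplus>\<^bsub>B\<^esub> b') = pure_tensor A B a b \<oplus>\<^bsub>T\<^esub> pure_tensor A B a b'"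
proof -
  note closed = M_single_closed[OF assms(1,2)] M_single_closed[OF assms(3,2)] M_single_closed[OF assms(1,4)]
  have "J +>\<^bsub>M\<^esub> Poly_Mapping.single (a \<oplus>\<^bsub>A\<^esub> a', b) 1 =
      J +>\<^bsub>M\<^esub> (Poly_Mapping.single (a, b) 1 \<oplus>\<^bsub>M\<^esub> Poly_Mapping.single (a', b) 1)"
    by (intro coset_eq M_single_closed M.a_closed) (use assms in \<open>auto simp: monoid_algebra_simps(4) bilinear_relations_def diff_diff_add\<close>)
  then show "pure_tensor A B (a \<oplus>\<^bsub>A\<^esub> a') b = pure_tensor A B a b \<oplus>\<^bsub>T\<^esub> pure_tensor A B a' b"
    by (simp add: pure_tensor_def ring_hom_add[OF coset_ring_hom] closed)
  have "J +>\<^bsub>M\<^esub> Poly_Mapping.single (a, b \<oplus>\<^bsub>B\<^esub> b') 1 =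
      J +>\<^bsub>M\<^esub> (Poly_Mapping.single (a, b) 1 \<oplus>\<^bsub>M\<^esub> Poly_Mapping.single (a, b') 1)"
    by (intro coset_eq M_single_closed M.a_closed) (use assms in \<open>auto simp: monoid_algebra_simps(4) bilinear_relations_def diff_diff_add\<close>)
  then show "pure_tensor A B a (b \<oplus>\<^bsub>B\<^esub> b') = pure_tensor A B a b \<oplus>\<^bsub>T\<^esub> pure_tensor A B a b'"
    by (simp add: pure_tensor_def ring_hom_add[OF coset_ring_hom] closed)
qed

lemma pure_tensor_smult:
  assumes "a \<in> carrier A" "b \<in> carrier B"
  shows "pure_tensor A B (k \<odot>\<^bsub>A\<^esub> a) b = k \<odot>\<^bsub>T\<^esub> pure_tensor A B a b"
    and "pure_tensor A B a (k \<odot>\<^bsub>B\<^esub> b) = k \<odot>\<^bsub>T\<^esub> pure_tensor A B a b"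
proof -
  \<comment> \<open>The coefficient \<open>k\<close> of the free vector space is the meeting point:
    the relations identify it with a scalar in either tensor factor.\<close>
  have k: "J +>\<^bsub>M\<^esub> Poly_Mapping.single (a, b) k = k \<odot>\<^bsub>T\<^esub> pure_tensor A B a b"
    using coset_smult[OF M_single_closed[OF assms], of k 1]
    by (simp only: pure_tensor_def monoid_algebra_simps(5) map_mult_single mult_1_right)
  have "J +>\<^bsub>M\<^esub> Poly_Mapping.single (k \<odot>\<^bsub>A\<^esub> a, b) 1 = J +>\<^bsub>M\<^esub> Poly_Mapping.single (a, b) k"
    "J +>\<^bsub>M\<^esub> Poly_Mapping.single (a, k \<odot>\<^bsub>B\<^esub> b) 1 = J +>\<^bsub>M\<^esub> Poly_Mapping.single (a, b) k"
    using assms by (intro coset_eq M_single_closed; auto simp: bilinear_relations_def)+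
  then show "pure_tensor A B (k \<odot>\<^bsub>A\<^esub> a) b = k \<odot>\<^bsub>T\<^esub> pure_tensor A B a b"
    "pure_tensor A B a (k \<odot>\<^bsub>B\<^esub> b) = k \<odot>\<^bsub>T\<^esub> pure_tensor A B a b"
    by (simp_all add: k flip: pure_tensor_def)
qed

lemma left_hom: "algebra_hom A T (\<lambda>a. pure_tensor A B a \<one>\<^bsub>B\<^esub>)"
  unfolding algebra_hom_def
  by (intro conjI ring_hom_memI ballI allI)
    (simp_all add: pure_tensor_closed pure_tensor_mult pure_tensor_one pure_tensor_smult
      pure_tensor_add(1)[OF _ B.one_closed _ B.one_closed])

lemma right_hom: "algebra_hom B T (\<lambda>b. pure_tensor A B \<one>\<^bsub>A\<^esub> b)"
  unfolding algebra_hom_def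
  by (intro conjI ring_hom_memI ballI allI)
    (simp_all add: pure_tensor_closed pure_tensor_mult pure_tensor_one pure_tensor_smult
      pure_tensor_add(2)[OF A.one_closed _ A.one_closed])

text \<open>Together with the homomorphisms from the two factors, this is all that is used about the
  tensor product later.\<close>

lemma left_right_commute:
  assumes "a \<in> carrier A" "b \<in> carrier B"
  shows "pure_tensor A B a \<one>\<^bsub>B\<^esub> \<otimes>\<^bsub>T\<^esub> pure_tensor A B \<one>\<^bsub>A\<^esub> b =
    pure_tensor A B \<one>\<^bsub>A\<^esub> b \<otimes>\<^bsub>T\<^esub> pure_tensor A B a \<one>\<^bsub>B\<^esub>"
  using assms by (simp add: pure_tensor_mult)

end

section \<open>Relations in the tensor product\<close>

lemma (in assoc_algebra) smult_zero_left: "a \<in> carrier A \<Longrightarrow> 0 \<odot> a = \<zero>"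
  using smult_l_distr[of a 0 0] by (simp add: add.l_cancel_one')

lemma (in assoc_algebra) smult_minus_one:
  assumes "a \<in> carrier A"
  shows "(- 1) \<odot> a = \<ominus> a"
  using assms smult_l_distr[of a "- 1" 1]
  by (intro minus_equality[symmetric]) (simp_all add: smult_one smult_zero_left)

lemma (in assoc_algebra) smult_two: "a \<in> carrier A \<Longrightarrow> 2 \<odot> a = a \<oplus> a"
  using smult_l_distr[of a 1 1] by (simp add: smult_one)

lemma algebra_hom_ring_hom_ring:
  assumes "assoc_algebra A" "assoc_algebra B" "algebra_hom A B h"
  shows "ring_hom_ring A B h"
  using assms by (intro ring_hom_ringI2) (simp_all add: assoc_algebra_def algebra_hom_def)

text \<open>Keeps \<open>i \<in> {1..N}\<close> in the form in which the closure rules expect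
  it.\<close>

declare One_nat_def [simp del] atLeastAtMost_iff [simp del]

lemma xp_relations_closed:
  "xp_relations N \<subseteq> carrier (free_algebra (xp_gens N) :: ('k::field, xp list \<Rightarrow>\<^sub>0 'k) module)"
proof -
  interpret F: assoc_algebra "free_algebra (xp_gens N) :: ('k, xp list \<Rightarrow>\<^sub>0 'k) module"
    by (rule free_algebra_assoc_algebra)
  have [simp]: "free_gen (GenX i) \<in> carrier (free_algebra (xp_gens N) :: ('k, xp list \<Rightarrow>\<^sub>0 'k) module)"
    "free_gen (GenP i) \<in> carrier (free_algebra (xp_gens N) :: ('k, xp list \<Rightarrow>\<^sub>0 'k) module)"
    if "i \<in> {1..N}" for i
    using that by (auto intro!: free_gen_closed simp: xp_gens_def)
  show ?thesis
    unfolding xp_relations_def Let_def commutator_def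
    by (auto intro!: F.minus_closed F.m_closed F.smult_closed F.finsum_closed F.a_inv_closed)
qed

lemma clifford_relations_closed:
  "clifford_relations N \<epsilon> \<subseteq> carrier (free_algebra {1..N} :: ('k::field, nat list \<Rightarrow>\<^sub>0 'k) module)"
proof -
  interpret F: assoc_algebra "free_algebra {1..N} :: ('k, nat list \<Rightarrow>\<^sub>0 'k) module"
    by (rule free_algebra_assoc_algebra)
  have [simp]: "free_gen i \<in> carrier (free_algebra {1..N} :: ('k, nat list \<Rightarrow>\<^sub>0 'k) module)"
    if "i \<in> {1..N}" for i
    using that by (rule free_gen_closed)
  show ?thesis
    unfolding clifford_relations_def Let_def
    by (auto intro!: F.minus_closed F.m_closed F.smult_closed F.a_closed)
qed

locale clifford_tensor =
  fixes N :: nat and \<epsilon> :: "'k::real_or_complex" and T (structure)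
  assumes T_def: "T = alg_AC N \<epsilon>"
begin

abbreviation "FA \<equiv> free_algebra (xp_gens N) :: ('k, xp list \<Rightarrow>\<^sub>0 'k) module"
abbreviation "FC \<equiv> free_algebra {1..N} :: ('k, nat list \<Rightarrow>\<^sub>0 'k) module"
abbreviation "\<A> \<equiv> alg_A N :: ('k, (xp list \<Rightarrow>\<^sub>0 'k) set) module"
abbreviation "\<C> \<equiv> alg_C N \<epsilon>"

sublocale FA: assoc_algebra FA by (rule free_algebra_assoc_algebra)
sublocale FC: assoc_algebra FC by (rule free_algebra_assoc_algebra)

lemma A_eq: "\<A> = alg_quot FA (genideal FA (xp_relations N))"
  by (simp add: alg_A_def presented_algebra_def)

lemma B_eq: "\<C> = alg_quot FC (genideal FC (clifford_relations N \<epsilon>))"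
  by (simp add: alg_C_def presented_algebra_def)

sublocale AB: tensor_product \<A> \<C>
  unfolding A_eq B_eq
  by (intro tensor_product.intro FA.genideal_quot_assoc_algebra FC.genideal_quot_assoc_algebra
      xp_relations_closed clifford_relations_closed)

lemma T_eq: "T = tensor_algebra \<A> \<C>"
  by (simp add: T_def alg_AC_def)

sublocale assoc_algebra T
  unfolding T_eq by (rule AB.T.assoc_algebra_axioms)

abbreviation "x \<equiv> x_el N \<epsilon>"
abbreviation "p \<equiv> p_el N \<epsilon>"
abbreviation "e \<equiv> e_el N \<epsilon>"

text \<open>With its counterpart \<open>hC\<close>, evaluates polynomials in free generators
  directly in the tensor product, so that each defining relation becomes an equation between the
  elements \<open>x i\<close>, \<open>p i\<close> and \<open>e i\<close>.\<close>

definition hA where "hA = (\<lambda>a. pure_tensor \<A> \<C> a \<one>\<^bsub>\<C>\<^esub>) \<circ> (\<lambda>f. genideal FA (xp_relations N) +>\<^bsub>FA\<^esub> f)"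
definition hC where "hC = (\<lambda>b. pure_tensor \<A> \<C> \<one>\<^bsub>\<A>\<^esub> b) \<circ> (\<lambda>f. genideal FC (clifford_relations N \<epsilon>) +>\<^bsub>FC\<^esub> f)"

lemma coset_A: "algebra_hom FA \<A> (\<lambda>f. genideal FA (xp_relations N) +>\<^bsub>FA\<^esub> f)"
  unfolding A_eq by (rule FA.genideal_quot_algebra_hom[OF xp_relations_closed])

lemma coset_B: "algebra_hom FC \<C> (\<lambda>f. genideal FC (clifford_relations N \<epsilon>) +>\<^bsub>FC\<^esub> f)"
  unfolding B_eq by (rule FC.genideal_quot_algebra_hom[OF clifford_relations_closed])

lemma hA_algebra_hom: "algebra_hom FA T hA"
  unfolding hA_def T_eq by (rule algebra_hom_comp[OF coset_A AB.left_hom])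

lemma hC_algebra_hom: "algebra_hom FC T hC"
  unfolding hC_def T_eq by (rule algebra_hom_comp[OF coset_B AB.right_hom])

sublocale hA: ring_hom_ring FA T hA
  by (rule algebra_hom_ring_hom_ring[OF FA.assoc_algebra_axioms assoc_algebra_axioms hA_algebra_hom])

sublocale hC: ring_hom_ring FC T hC
  by (rule algebra_hom_ring_hom_ring[OF FC.assoc_algebra_axioms assoc_algebra_axioms hC_algebra_hom])

lemma hA_smult: "a \<in> carrier FA \<Longrightarrow> hA (c \<odot>\<^bsub>FA\<^esub> a) = c \<odot> hA a"
  and hC_smult: "b \<in> carrier FC \<Longrightarrow> hC (c \<odot>\<^bsub>FC\<^esub> b) = c \<odot> hC b"
  using hA_algebra_hom hC_algebra_hom unfolding algebra_hom_def by blast+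

lemma hA_relation:
  assumes "r \<in> xp_relations N"
  shows "hA r = \<zero>"
proof -
  interpret L: ring_hom_ring \<A> T "\<lambda>a. pure_tensor \<A> \<C> a \<one>\<^bsub>\<C>\<^esub>"
    unfolding T_eq
    by (rule algebra_hom_ring_hom_ring[OF AB.A.assoc_algebra_axioms AB.T.assoc_algebra_axioms AB.left_hom])
  show ?thesis
    using FA.genideal_quot_relation[OF xp_relations_closed assms] L.hom_zero
    by (simp add: hA_def A_eq)
qed

lemma hC_relation:
  assumes "r \<in> clifford_relations N \<epsilon>"
  shows "hC r = \<zero>"
proof -
  interpret L: ring_hom_ring \<C> T "\<lambda>b. pure_tensor \<A> \<C> \<one>\<^bsub>\<A>\<^esub> b"
    unfolding T_eq
    by (rule algebra_hom_ring_hom_ring[OF AB.B.assoc_algebra_axioms AB.T.assoc_algebra_axioms AB.right_hom])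
  show ?thesis
    using FC.genideal_quot_relation[OF clifford_relations_closed assms] L.hom_zero
    by (simp add: hC_def B_eq)
qed

lemma gen_closed:
  assumes "i \<in> {1..N}"
  shows "free_gen (GenX i) \<in> carrier FA" "free_gen (GenP i) \<in> carrier FA" "free_gen i \<in> carrier FC"
  using assms by (auto intro!: free_gen_closed simp: xp_gens_def)

lemma h_gen: "hA (free_gen (GenX i)) = x i" "hA (free_gen (GenP i)) = p i" "hC (free_gen i) = e i"
  by (simp_all add: hA_def hC_def x_el_def p_el_def e_el_def presented_gen_def)

lemma closed [simp, intro]:
  assumes "i \<in> {1..N}"
  shows "x i \<in> carrier T" "p i \<in> carrier T" "e i \<in> carrier T"
  using gen_closed[OF assms] hA.hom_closed hC.hom_closed by (simp_all flip: h_gen)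

lemma hA_hC_commute:
  assumes "a \<in> carrier FA" "b \<in> carrier FC"
  shows "hA a \<otimes> hC b = hC b \<otimes> hA a"
proof -
  have "genideal FA (xp_relations N) +>\<^bsub>FA\<^esub> a \<in> carrier \<A>"
    "genideal FC (clifford_relations N \<epsilon>) +>\<^bsub>FC\<^esub> b \<in> carrier \<C>"
    using assms coset_A coset_B ring_hom_closed unfolding algebra_hom_def by metis+
  then show ?thesis
    unfolding T_eq hA_def hC_def comp_def by (rule AB.left_right_commute)
qed

lemma e_commute:
  assumes "i \<in> {1..N}" "j \<in> {1..N}"
  shows "x i \<otimes> e j = e j \<otimes> x i" "p i \<otimes> e j = e j \<otimes> p i"
  using hA_hC_commute gen_closed assms by (simp_all flip: h_gen)

lemma x_commute:
  assumes ij: "i \<in> {1..N}" "j \<in> {1..N}"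
  shows "x i \<otimes> x j = x j \<otimes> x i"
proof -
  have "hA (commutator FA (free_gen (GenX i)) (free_gen (GenX j))) = \<zero>"
    \<comment> \<open>The \<open>UnI\<close> rules select one of the four families whose union is
      \<open>xp_relations N\<close>; the same pattern is used for the other three.\<close>
    by (rule hA_relation, unfold xp_relations_def Let_def, rule UnI1, rule UnI1, rule UnI1) (use ij in blast)
  then show ?thesis
    using ij by (simp add: commutator_def FA.minus_eq gen_closed h_gen minus_eq[symmetric] r_right_minus_eq)
qed

lemma p_commute:
  assumes ij: "i \<in> {1..N}" "j \<in> {1..N}"
  shows "p i \<otimes> p j = p j \<otimes> p i"
proof -
  have "hA (commutator FA (free_gen (GenP i)) (free_gen (GenP j))) = \<zero>"
    by (rule hA_relation, unfold xp_relations_def Let_def, rule UnI1, rule UnI1, rule UnI2) (use ij in blast)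
  then show ?thesis
    using ij by (simp add: commutator_def FA.minus_eq gen_closed h_gen minus_eq[symmetric] r_right_minus_eq)
qed

definition "\<Delta> = (1/2) \<odot> (\<Oplus>i\<in>{1..N}. p i \<otimes> p i)"
definition "\<rho> = (1/2) \<odot> (\<Oplus>i\<in>{1..N}. x i \<otimes> x i)"

lemma \<Delta>_closed: "\<Delta> \<in> carrier T" and \<rho>_closed: "\<rho> \<in> carrier T"
  by (auto simp: \<Delta>_def \<rho>_def intro!: smult_closed finsum_closed)

lemma hA_squares:
  "hA ((1/2) \<odot>\<^bsub>FA\<^esub> (\<Oplus>\<^bsub>FA\<^esub>i\<in>{1..N}. free_gen (GenP i) \<otimes>\<^bsub>FA\<^esub> free_gen (GenP i))) = \<Delta>"
  "hA ((1/2) \<odot>\<^bsub>FA\<^esub> (\<Oplus>\<^bsub>FA\<^esub>i\<in>{1..N}. free_gen (GenX i) \<otimes>\<^bsub>FA\<^esub> free_gen (GenX i))) = \<rho>"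
proof -
  have f: "(\<lambda>i. free_gen (GenP i) \<otimes>\<^bsub>FA\<^esub> free_gen (GenP i)) \<in> {1..N} \<rightarrow> carrier FA"
    "(\<lambda>i. free_gen (GenX i) \<otimes>\<^bsub>FA\<^esub> free_gen (GenX i)) \<in> {1..N} \<rightarrow> carrier FA"
    using gen_closed by (auto)
  have "(\<Oplus>i\<in>{1..N}. (hA \<circ> (\<lambda>i. free_gen (GenP i) \<otimes>\<^bsub>FA\<^esub> free_gen (GenP i))) i) = (\<Oplus>i\<in>{1..N}. p i \<otimes> p i)"
    "(\<Oplus>i\<in>{1..N}. (hA \<circ> (\<lambda>i. free_gen (GenX i) \<otimes>\<^bsub>FA\<^esub> free_gen (GenX i))) i) = (\<Oplus>i\<in>{1..N}. x i \<otimes> x i)"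
    by (intro finsum_cong'; auto simp: gen_closed h_gen)+
  then show "hA ((1/2) \<odot>\<^bsub>FA\<^esub> (\<Oplus>\<^bsub>FA\<^esub>i\<in>{1..N}. free_gen (GenP i) \<otimes>\<^bsub>FA\<^esub> free_gen (GenP i))) = \<Delta>"
    "hA ((1/2) \<odot>\<^bsub>FA\<^esub> (\<Oplus>\<^bsub>FA\<^esub>i\<in>{1..N}. free_gen (GenX i) \<otimes>\<^bsub>FA\<^esub> free_gen (GenX i))) = \<rho>"
    unfolding \<Delta>_def \<rho>_def
    using hA.hom_finsum[OF f(1)] hA.hom_finsum[OF f(2)] FA.finsum_closed[OF f(1)] FA.finsum_closed[OF f(2)]
    by (simp_all add: hA_smult comp_def)
qed

lemma squares_closed:
  "(1/2) \<odot>\<^bsub>FA\<^esub> (\<Oplus>\<^bsub>FA\<^esub>i\<in>{1..N}. free_gen (GenP i) \<otimes>\<^bsub>FA\<^esub> free_gen (GenP i)) \<in> carrier FA"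
  "(1/2) \<odot>\<^bsub>FA\<^esub> (\<Oplus>\<^bsub>FA\<^esub>i\<in>{1..N}. free_gen (GenX i) \<otimes>\<^bsub>FA\<^esub> free_gen (GenX i)) \<in> carrier FA"
  using gen_closed by (auto intro!: FA.smult_closed FA.finsum_closed)

lemma \<Delta>_x:
  assumes j: "j \<in> {1..N}"
  shows "\<Delta> \<otimes> x j \<ominus> x j \<otimes> \<Delta> = p j"
proof -
  let ?P = "(1/2) \<odot>\<^bsub>FA\<^esub> (\<Oplus>\<^bsub>FA\<^esub>i\<in>{1..N}. free_gen (GenP i) \<otimes>\<^bsub>FA\<^esub> free_gen (GenP i))"
  have "hA (commutator FA ?P (free_gen (GenX j)) \<ominus>\<^bsub>FA\<^esub> free_gen (GenP j)) = \<zero>"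
    by (rule hA_relation, unfold xp_relations_def Let_def, rule UnI1, rule UnI2) (use j in blast)
  then have "\<Delta> \<otimes> x j \<ominus> x j \<otimes> \<Delta> \<ominus> p j = \<zero>"
    using gen_closed[OF j] squares_closed hA_squares
    by (simp add: commutator_def FA.minus_eq h_gen minus_eq)
  then show ?thesis
    using j \<Delta>_closed by (subst (asm) r_right_minus_eq) simp_all
qed

lemma \<rho>_p:
  assumes j: "j \<in> {1..N}"
  shows "\<rho> \<otimes> p j \<ominus> p j \<otimes> \<rho> = \<ominus> x j"
proof -
  let ?P = "(1/2) \<odot>\<^bsub>FA\<^esub> (\<Oplus>\<^bsub>FA\<^esub>i\<in>{1..N}. free_gen (GenX i) \<otimes>\<^bsub>FA\<^esub> free_gen (GenX i))"
  have "hA (commutator FA ?P (free_gen (GenP j)) \<ominus>\<^bsub>FA\<^esub> (\<ominus>\<^bsub>FA\<^esub> free_gen (GenX j))) = \<zero>"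
    by (rule hA_relation, unfold xp_relations_def Let_def, rule UnI2) (use j in blast)
  then have "\<rho> \<otimes> p j \<ominus> p j \<otimes> \<rho> \<ominus> (\<ominus> x j) = \<zero>"
    using gen_closed[OF j] closed[OF j] squares_closed hA_squares
    by (simp add: commutator_def FA.minus_eq h_gen minus_eq)
  then show ?thesis
    using j \<rho>_closed by (subst (asm) r_right_minus_eq) simp_all
qed

lemma e_e:
  assumes ij: "i \<in> {1..N}" "j \<in> {1..N}"
  shows "e i \<otimes> e j \<oplus> e j \<otimes> e i = (2 * \<epsilon> * (if i = j then 1 else 0)) \<odot> \<one>"
proof -
  have "hC ((free_gen i \<otimes>\<^bsub>FC\<^esub> free_gen j \<oplus>\<^bsub>FC\<^esub> free_gen j \<otimes>\<^bsub>FC\<^esub> free_gen i)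
      \<ominus>\<^bsub>FC\<^esub> (2 * \<epsilon> * (if i = j then 1 else 0)) \<odot>\<^bsub>FC\<^esub> \<one>\<^bsub>FC\<^esub>) = \<zero>"
    using ij by (intro hC_relation) (force simp: clifford_relations_def Let_def)
  then have "(e i \<otimes> e j \<oplus> e j \<otimes> e i) \<ominus> (2 * \<epsilon> * (if i = j then 1 else 0)) \<odot> \<one> = \<zero>"
    using gen_closed[OF ij(1)] gen_closed[OF ij(2)]
    by (simp add: FC.minus_eq h_gen minus_eq hC_smult)
  then show ?thesis
    using ij by (subst (asm) r_right_minus_eq) auto
qed

lemma e_anti:
  assumes "i \<in> {1..N}" "j \<in> {1..N}" "i \<noteq> j"
  shows "e i \<otimes> e j = \<ominus> (e j \<otimes> e i)"
  using e_e[OF assms(1,2)] assms by (intro minus_equality[symmetric]) (simp_all add: smult_zero_left)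

lemma half_double: "a \<in> carrier T \<Longrightarrow> (1/2) \<odot> (a \<oplus> a) = a"
  by (simp add: smult_assoc[symmetric] smult_one flip: smult_two)

lemma double_half: "a \<in> carrier T \<Longrightarrow> (1/2) \<odot> a \<oplus> (1/2) \<odot> a = a"
  by (simp add: smult_one flip: smult_l_distr)

text \<open>The Clifford relation with equal indices only gives the doubled identity. It has to be
  halved here, where scalars exist, since the abstract ring does not permit it.\<close>

lemma e_square:
  assumes "i \<in> {1..N}"
  shows "e i \<otimes> e i = \<epsilon> \<odot> \<one>"
proof -
  have "(1/2) \<odot> (e i \<otimes> e i \<oplus> e i \<otimes> e i) = (1/2) \<odot> ((2 * \<epsilon>) \<odot> \<one>)"
    using e_e[OF assms assms] by simp
  then show ?thesis
    using assms by (simp add: half_double smult_assoc[symmetric])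
qed

section \<open>Transfer to the type of class ring\<close>

abbreviation "\<iota> \<equiv> coordinate T"

sublocale W: clifford_weyl "{1..N}" "\<lambda>i. \<iota> (e i)" "\<lambda>i. \<iota> (x i)" "\<lambda>i. \<iota> (p i)" "\<iota> (\<epsilon> \<odot> \<one>)" "\<iota> \<one>"
  "\<iota> \<Delta>" "\<iota> \<rho>"
proof
  have "\<Delta> \<oplus> \<Delta> = (\<Oplus>i\<in>{1..N}. p i \<otimes> p i)" "\<rho> \<oplus> \<rho> = (\<Oplus>i\<in>{1..N}. x i \<otimes> x i)"
    unfolding \<Delta>_def \<rho>_def
    by (intro double_half finsum_closed; auto)+
  then have "\<iota> \<Delta> + \<iota> \<Delta> = \<iota> (\<Oplus>i\<in>{1..N}. p i \<otimes> p i)" "\<iota> \<rho> + \<iota> \<rho> = \<iota> (\<Oplus>i\<in>{1..N}. x i \<otimes> x i)"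
    using \<Delta>_closed \<rho>_closed by (simp_all flip: coordinate_add)
  moreover have "\<iota> (\<Oplus>i\<in>{1..N}. p i \<otimes> p i) = (\<Sum>i\<in>{1..N}. \<iota> (p i) * \<iota> (p i))"
    "\<iota> (\<Oplus>i\<in>{1..N}. x i \<otimes> x i) = (\<Sum>i\<in>{1..N}. \<iota> (x i) * \<iota> (x i))"
    by (subst coordinate_finsum; auto simp: coordinate_mult intro!: sum.cong)+
  ultimately show "\<iota> \<Delta> + \<iota> \<Delta> = (\<Sum>i\<in>{1..N}. \<iota> (p i) * \<iota> (p i))"
    "\<iota> \<rho> + \<iota> \<rho> = (\<Sum>i\<in>{1..N}. \<iota> (x i) * \<iota> (x i))"
    by simp_all
next
  fix i j assume ij: "i \<in> {1..N}" "j \<in> {1..N}"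
  show "i \<noteq> j \<Longrightarrow> \<iota> (e i) * \<iota> (e j) = - (\<iota> (e j) * \<iota> (e i))"
    using e_anti[OF ij] ij closed by (metis coordinate_mult coordinate_uminus m_closed)
  show "\<iota> (x i) * \<iota> (e j) = \<iota> (e j) * \<iota> (x i)" "\<iota> (p i) * \<iota> (e j) = \<iota> (e j) * \<iota> (p i)"
    "\<iota> (x i) * \<iota> (x j) = \<iota> (x j) * \<iota> (x i)" "\<iota> (p i) * \<iota> (p j) = \<iota> (p j) * \<iota> (p i)"
    using e_commute[OF ij] x_commute[OF ij] p_commute[OF ij] closed[OF ij(1)] closed[OF ij(2)]
    by (metis coordinate_mult)+
next
  fix i assume i: "i \<in> {1..N}"
  show "\<iota> (e i) * \<iota> (e i) = \<iota> (\<epsilon> \<odot> \<one>)"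
    using e_square[OF i] closed[OF i] by (metis coordinate_mult)
  show "\<iota> \<Delta> * \<iota> (x i) - \<iota> (x i) * \<iota> \<Delta> = \<iota> (p i)"
    using \<Delta>_x[OF i] closed[OF i] \<Delta>_closed by (metis coordinate_mult coordinate_minus m_closed)
  show "\<iota> \<rho> * \<iota> (p i) - \<iota> (p i) * \<iota> \<rho> = - \<iota> (x i)"
    using \<rho>_p[OF i] closed[OF i] \<rho>_closed by (metis coordinate_mult coordinate_minus coordinate_uminus m_closed)
  show "\<iota> \<one> * \<iota> (e i) = \<iota> (e i) * \<iota> \<one>" "\<iota> \<one> * \<iota> (x i) = \<iota> (x i) * \<iota> \<one>"
    "\<iota> \<one> * \<iota> (p i) = \<iota> (p i) * \<iota> \<one>"
    using closed[OF i] by (simp_all flip: coordinate_mult)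
qed simp

lemma \<iota>_e_list:
  assumes "set A \<subseteq> {1..N}"
  shows "e_list N \<epsilon> A \<in> carrier T" "\<iota> (e_list N \<epsilon> A) = W.E A"
  using assms by (induction A) (simp_all add: e_list_def W.E_def coordinate_mult flip: T_def)

lemma \<iota>_sum_mult:
  assumes "\<And>i. i \<in> X \<Longrightarrow> f i \<in> carrier T" "\<And>i. i \<in> X \<Longrightarrow> g i \<in> carrier T" "finite X"
  shows "(\<Oplus>i\<in>X. f i \<otimes> g i) \<in> carrier T" "\<iota> (\<Oplus>i\<in>X. f i \<otimes> g i) = (\<Sum>i\<in>X. \<iota> (f i) * \<iota> (g i))"
proof -
  have "(\<lambda>i. f i \<otimes> g i) \<in> X \<rightarrow> carrier T" using assms by auto
  then show "(\<Oplus>i\<in>X. f i \<otimes> g i) \<in> carrier T" "\<iota> (\<Oplus>i\<in>X. f i \<otimes> g i) = (\<Sum>i\<in>X. \<iota> (f i) * \<iota> (g i))"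
    using assms by (simp_all add: coordinate_finsum coordinate_mult)
qed

lemma \<iota>_D_full: "D_full N \<epsilon> \<in> carrier T" "\<iota> (D_full N \<epsilon>) = W.DD"
  using \<iota>_sum_mult[of "{1..N}" e p] by (simp_all add: D_full_def W.DD_def flip: T_def)

lemma \<iota>_x_full: "x_full N \<epsilon> \<in> carrier T" "\<iota> (x_full N \<epsilon>) = W.XX"
  using \<iota>_sum_mult[of "{1..N}" e x] by (simp_all add: x_full_def W.XX_def flip: T_def)

context
  fixes A assumes A: "set A \<subseteq> {1..N}"
begin

lemma in_range: "a \<in> set A \<Longrightarrow> a \<in> {1..N}"
  using A by blast

lemma \<iota>_D_list: "D_list N \<epsilon> A \<in> carrier T" "\<iota> (D_list N \<epsilon> A) = W.DL A"
  using \<iota>_sum_mult[of "set A" p e] in_range by (simp_all add: D_list_def W.DL_def flip: T_def)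

lemma \<iota>_x_list: "x_list N \<epsilon> A \<in> carrier T" "\<iota> (x_list N \<epsilon> A) = W.XL A"
  using \<iota>_sum_mult[of "set A" x e] in_range by (simp_all add: x_list_def W.XL_def flip: T_def)

lemma \<iota>_C:
  assumes "i \<in> {1..N}" "j \<in> {1..N}"
  shows "C_el N \<epsilon> i j \<in> carrier T" "\<iota> (C_el N \<epsilon> i j) = W.C i j"
  using assms by (simp_all add: C_el_def commutator_def W.C_def coordinate_minus coordinate_mult flip: T_def)

lemma \<iota>_L:
  assumes "i \<in> {1..N}" "j \<in> {1..N}"
  shows "L_el N \<epsilon> i j \<in> carrier T" "\<iota> (L_el N \<epsilon> i j) = W.L i j"
  using assms by (simp_all add: L_el_def W.L_def coordinate_minus coordinate_mult flip: T_def)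

lemma \<iota>_C_sum: "C_sum N \<epsilon> A \<in> carrier T" "\<iota> (C_sum N \<epsilon> A) = W.CS A"
proof -
  let ?f = "\<lambda>j i. C_el N \<epsilon> i j \<otimes> e i \<otimes> e j"
  let ?S = "\<lambda>j. {1..N} - (set A - {j})"
  have f: "?f j \<in> ?S j \<rightarrow> carrier T" if "j \<in> set A" for j
    using in_range[OF that] by (auto simp: \<iota>_C)
  then have S: "(\<lambda>j. \<Oplus>i\<in>?S j. ?f j i) \<in> set A \<rightarrow> carrier T"
    by (auto intro!: finsum_closed)
  show "C_sum N \<epsilon> A \<in> carrier T"
    unfolding C_sum_def T_def[symmetric] by (rule finsum_closed[OF S])
  have "\<iota> (\<Oplus>i\<in>?S j. ?f j i) = (\<Sum>i\<in>?S j. W.C i j * \<iota> (e i) * \<iota> (e j))" if "j \<in> set A" for j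
    using in_range[OF that]
    by (subst coordinate_finsum[OF _ f[OF that]]) (auto intro!: sum.cong simp: coordinate_mult \<iota>_C)
  then show "\<iota> (C_sum N \<epsilon> A) = W.CS A"
    unfolding C_sum_def T_def[symmetric] W.CS_def
    by (subst coordinate_finsum[OF _ S]) auto
qed

lemma \<iota>_L_sum: "L_sum N \<epsilon> A \<in> carrier T" "\<iota> (L_sum N \<epsilon> A) = W.LS A"
proof -
  let ?P = "{(i, j). i \<in> set A \<and> j \<in> set A \<and> i < j}"
  let ?f = "\<lambda>s. case s of (i, j) \<Rightarrow> 2 \<odot> (L_el N \<epsilon> i j \<otimes> e i \<otimes> e j)"
  have f: "?f \<in> ?P \<rightarrow> carrier T"
    using in_range by (auto simp: \<iota>_L)
  have fin: "finite ?P"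
    by (rule finite_subset[of _ "set A \<times> set A"]) auto
  show "L_sum N \<epsilon> A \<in> carrier T"
    unfolding L_sum_def T_def[symmetric] by (rule finsum_closed[OF f])
  show "\<iota> (L_sum N \<epsilon> A) = W.LS A"
    unfolding L_sum_def T_def[symmetric] W.LS_def using in_range
    by (subst coordinate_finsum[OF fin f])
      (auto intro!: sum.cong simp: smult_two coordinate_add coordinate_mult \<iota>_L)
qed

end

lemma smult_sign: "a \<in> carrier T \<Longrightarrow> ((-1) ^ n) \<odot> a = (if even n then a else \<ominus> a)"
  by (simp add: minus_one_power_iff smult_one smult_minus_one)

text \<open>\<open>V\<close> is \<open>2 O_A\<close>. The factor one half is postponed because the
  codomain of \<open>\<iota>\<close> has no scalar multiplication.\<close>

lemma symmetries:
  fixes A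
  defines "E \<equiv> e_list N \<epsilon> A" and "D \<equiv> D_full N \<epsilon>" and "X \<equiv> x_full N \<epsilon>"
    and "DA \<equiv> D_list N \<epsilon> A" and "XA \<equiv> x_list N \<epsilon> A"
  defines "V \<equiv> D \<otimes> XA \<otimes> E \<ominus> E \<otimes> XA \<otimes> D \<ominus> \<epsilon> \<odot> E"
  assumes A: "distinct A" "set A \<subseteq> {1..N}"
  shows "V \<in> carrier T"
    and "V = E \<otimes> DA \<otimes> X \<ominus> X \<otimes> DA \<otimes> E \<ominus> \<epsilon> \<odot> E" (is "V = ?V2")
    and "V = (\<ominus> (\<epsilon> \<odot> \<one>) \<oplus> C_sum N \<epsilon> A \<ominus> L_sum N \<epsilon> A) \<otimes> E" (is "V = ?V3")
    and "D \<otimes> V = ((-1) ^ length A) \<odot> (V \<otimes> D)"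
    and "X \<otimes> V = ((-1) ^ length A) \<odot> (V \<otimes> X)"
proof -
  have closed: "E \<in> carrier T" "D \<in> carrier T" "X \<in> carrier T" "DA \<in> carrier T" "XA \<in> carrier T"
    "C_sum N \<epsilon> A \<in> carrier T" "L_sum N \<epsilon> A \<in> carrier T"
    using \<iota>_e_list \<iota>_D_full \<iota>_x_full \<iota>_D_list \<iota>_x_list \<iota>_C_sum \<iota>_L_sum A
    by (simp_all add: E_def D_def X_def DA_def XA_def)
  have \<iota>: "\<iota> E = W.E A" "\<iota> D = W.DD" "\<iota> X = W.XX" "\<iota> DA = W.DL A" "\<iota> XA = W.XL A"
    "\<iota> (C_sum N \<epsilon> A) = W.CS A" "\<iota> (L_sum N \<epsilon> A) = W.LS A"
    using \<iota>_e_list \<iota>_D_full \<iota>_x_full \<iota>_D_list \<iota>_x_list \<iota>_C_sum \<iota>_L_sum A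
    by (simp_all add: E_def D_def X_def DA_def XA_def)
  note simps = coordinate_add coordinate_mult coordinate_minus coordinate_uminus \<iota> closed
  \<comment> \<open>The scalar is turned into a ring element, which \<open>\<iota>\<close> sends to
    \<open>q\<close>.\<close>
  have "\<epsilon> \<odot> E = (\<epsilon> \<odot> \<one>) \<otimes> E"
    using closed by (simp add: smult_mult_left)
  then have q: "\<iota> (\<epsilon> \<odot> E) = \<iota> (\<epsilon> \<odot> \<one>) * W.E A"
    by (simp add: simps)
  have V: "\<iota> V = W.DD * W.XL A * W.E A - W.E A * W.XL A * W.DD - \<iota> (\<epsilon> \<odot> \<one>) * W.E A"
    by (simp add: V_def simps q)
  have V2: "\<iota> ?V2 = W.E A * W.DL A * W.XX - W.XX * W.DL A * W.E A - \<iota> (\<epsilon> \<odot> \<one>) * W.E A"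
    by (simp add: simps q)
  have V3: "\<iota> ?V3 = (- \<iota> (\<epsilon> \<odot> \<one>) + W.CS A - W.LS A) * W.E A"
    by (simp add: simps)
  show closed_V: "V \<in> carrier T" by (simp add: V_def closed)
  show "V = ?V2"
    using closed_V by (subst coordinate_inject[symmetric])
      (simp_all only: V V2 W.first_eq_third[OF A] W.second_eq_third[OF A], simp add: closed)
  \<comment> \<open>The rule for \<open>X\<close> is proved for the second form; this equality
    carries it over to \<open>V\<close>.\<close>
  then have X: "\<iota> V = \<iota> ?V2" by simp
  show "V = ?V3"
    using closed_V by (subst coordinate_inject[symmetric])
      (simp_all only: V V3 W.first_eq_third[OF A], simp_all add: closed algebra_simps)
  show "D \<otimes> V = ((-1) ^ length A) \<odot> (V \<otimes> D)"
    using closed_V closed W.DD_first[OF A, folded V]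
    by (subst coordinate_inject[symmetric]) (auto simp: smult_sign simps)
  show "X \<otimes> V = ((-1) ^ length A) \<odot> (V \<otimes> X)"
    using closed_V closed W.XX_second[OF A, folded V2, folded X]
    by (subst coordinate_inject[symmetric]) (auto simp: smult_sign simps)
qed

end

theorem theorem3p7:
  fixes N :: nat
    and \<epsilon> :: "'k::real_or_complex"
    and A :: "nat list"
    and T (structure)
    and D x D\<^sub>A x\<^sub>A e\<^sub>A O\<^sub>A :: "'k AC"
  assumes "N \<ge> 1"
    and "\<epsilon> \<in> {1, -1}"
    and "distinct A"
    and "set A \<subseteq> {1..N}"
    and "T = alg_AC N \<epsilon>"
    and "D = D_full N \<epsilon>"
    and "x = x_full N \<epsilon>"
    and "D\<^sub>A = D_list N \<epsilon> A"
    and "x\<^sub>A = x_list N \<epsilon> A"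
    and "e\<^sub>A = e_list N \<epsilon> A"
    and "O\<^sub>A = (1/2) \<odot> ((D \<otimes> x\<^sub>A \<otimes> e\<^sub>A) \<ominus> (e\<^sub>A \<otimes> x\<^sub>A \<otimes> D) \<ominus> (\<epsilon> \<odot> e\<^sub>A))"
  shows "O\<^sub>A = (1/2) \<odot> ((e\<^sub>A \<otimes> D\<^sub>A \<otimes> x) \<ominus> (x \<otimes> D\<^sub>A \<otimes> e\<^sub>A) \<ominus> (\<epsilon> \<odot> e\<^sub>A)) \<and>
    O\<^sub>A = (1/2) \<odot> (((\<ominus> (\<epsilon> \<odot> \<one>)) \<oplus> C_sum N \<epsilon> A \<ominus> L_sum N \<epsilon> A) \<otimes> e\<^sub>A) \<and>
    D \<otimes> O\<^sub>A = ((-1) ^ length A) \<odot> (O\<^sub>A \<otimes> D) \<and>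
    x \<otimes> O\<^sub>A = ((-1) ^ length A) \<odot> (O\<^sub>A \<otimes> x)"
proof -
  interpret clifford_tensor N \<epsilon> T
    by standard (fact assms(5))
  let ?V = "(D \<otimes> x\<^sub>A \<otimes> e\<^sub>A) \<ominus> (e\<^sub>A \<otimes> x\<^sub>A \<otimes> D) \<ominus> (\<epsilon> \<odot> e\<^sub>A)"
  note V = symmetries[OF assms(3,4), folded assms(6-10)]
  have closed: "D \<in> carrier T" "x \<in> carrier T"
    using \<iota>_D_full \<iota>_x_full assms(6,7) by simp_all
  \<comment> \<open>Scalars can be pulled out of either factor of a product and commute with the
    sign, so the factor one half passes through the identity for \<open>?V\<close>.\<close>
  have half: "y \<otimes> O\<^sub>A = ((-1) ^ length A) \<odot> (O\<^sub>A \<otimes> y)"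
    if "y \<in> carrier T" "y \<otimes> ?V = ((-1) ^ length A) \<odot> (?V \<otimes> y)" for y
    unfolding assms(11) using that V(1)
    by (simp add: smult_mult_left smult_mult_right smult_assoc[symmetric] mult.commute)
  show ?thesis
    using V(2,3) half[OF closed(1) V(4)] half[OF closed(2) V(5)] assms(11) by simp
qed

end
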